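(* Let $p$ be an odd prime. The following two statements are equivalent. (a) For every $p$-uniform hypergraph with vertex set $\mathbb N$ and edge set $\mathcal F$ having infinite chromatic number, the Cayley graph $\mathrm{Cay}(\mathbb F_p^\omega,\mathcal E(\mathcal F))$ has infinite chromatic number. (b) Every subset of $\mathbb F_p^\omega$ which is a set of Bohr recurrence is a set of chromatic recurrence.
   Context: $\mathbb F_p$ is the additive group $\mathbb Z/p\mathbb Z$, and $\mathbb F_p^\omega$ is the (discrete) direct sum of countably many copies of $\mathbb F_p$, with standard basis $(\mathbf e_i)_{i\in\mathbb N}$. For a finite $F\subseteq\mathbb N$, $\mathbf e_F:=\sum_{n\in F}\mathbf e_n$; for a collection $\mathcal F$ of finite subsets of $\mathbb N$, $\mathcal E(\mathcal F):=\{\mathbf e_F:F\in\mathcal F\}\subseteq\mathbb F_p^\omega$. A hypergraph with vertex set $V$ and edge set $\mathcal F$ (a collection of subsets of $V$) is $p$-uniform if every $F\in\mathcal F$ has cardinality $p$. Its chromatic number is the minimum $k\in\mathbb N$ such that $V$ may be partitioned into $k$ sets where no $F\in\mathcal F$ lies in one cell of the partition; if no such $k$ exists, the hypergraph has infinite chromatic number. For an abelian group $G$ and $V,S\subseteq G$, the Cayley graph $\mathrm{Cay}(V,S)$ has vertex set $V$, with two vertices $g,g'$ joined by an edge if $g-g'\in S$ or $g'-g\in S$. Its chromatic number is the usual graph chromatic number (infinite if no proper coloring with finitely many colors exists). $\mathbb T=\mathbb R/\mathbb Z$; for $\mathbf x=(x_1,\dots,x_d)\in\mathbb T^d$, $\|\mathbf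 x\|:=\max_{j\le d}\min_{n\in\mathbb Z}|x_j-n|$. For a discrete abelian group $G$: $S\subseteq G$ is a set of Bohr recurrence if for every $d\in\mathbb N$, every homomorphism $\rho:G\to\mathbb T^d$, and every $\varepsilon>0$, there exists $s\in S$ with $\|\rho(s)\|<\varepsilon$; $S\subseteq G$ is a set of chromatic recurrence if for every $r\in\mathbb N$ and every $f:G\to\{1,\dots,r\}$ there exist $a,b\in G$ such that $f(a)=f(b)$ and $b-a\in S$. *)

theory Defs
  imports
    Complex_Main
    "HOL-Library.Extended_Nat"
    "HOL-Library.Disjoint_Sets"
    "HOL-Computational_Algebra.Primes"
    "HOL-Algebra.FiniteProduct"
    "HOL-Algebra.Product_Groups"
begin

text \<open>Graphs and hypergraphs are pairs of a vertex set and a set of edges, an edge being the set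
  of its vertices; a singleton edge of a graph is a loop.\<close>

type_synonym 'a hypergraph = "'a set \<times> 'a set set"

definition uniform_hypergraph :: "nat \<Rightarrow> 'a hypergraph \<Rightarrow> bool" where
  "uniform_hypergraph k H \<longleftrightarrow> (\<forall>F\<in>snd H. F \<subseteq> fst H \<and> finite F \<and> card F = k)"

definition partition_colourable :: "'a hypergraph \<Rightarrow> nat \<Rightarrow> bool" where
  "partition_colourable H k \<longleftrightarrow>
     (\<exists>P. partition_on (fst H) P \<and> finite P \<and> card P = k \<and> (\<forall>F\<in>snd H. \<forall>C\<in>P. \<not> F \<subseteq> C))"

definition hypergraph_chromatic_number :: "'a hypergraph \<Rightarrow> enat" where
  "hypergraph_chromatic_number H =
     (if \<exists>k. partition_colourable H k then enat (LEAST k. partition_colourable H k) else \<infinity>)"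

definition proper_colouring :: "'a hypergraph \<Rightarrow> nat \<Rightarrow> ('a \<Rightarrow> nat) \<Rightarrow> bool" where
  "proper_colouring H k c \<longleftrightarrow>
     c \<in> fst H \<rightarrow> {..<k} \<and> (\<forall>u\<in>fst H. \<forall>v\<in>fst H. {u, v} \<in> snd H \<longrightarrow> c u \<noteq> c v)"

definition graph_chromatic_number :: "'a hypergraph \<Rightarrow> enat" where
  "graph_chromatic_number H =
     (if \<exists>k c. proper_colouring H k c then enat (LEAST k. \<exists>c. proper_colouring H k c) else \<infinity>)"

definition group_diff :: "('a, 'b) monoid_scheme \<Rightarrow> 'a \<Rightarrow> 'a \<Rightarrow> 'a" where
  "group_diff G x y = x \<otimes>\<^bsub>G\<^esub> inv\<^bsub>G\<^esub> y"

definition Cay :: "('a, 'b) monoid_scheme \<Rightarrow> 'a set \<Rightarrow> 'a set \<Rightarrow> 'a hypergraph" where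
  "Cay G V S =
     (V, {{g, g'} | g g'. g \<in> V \<and> g' \<in> V \<and> (group_diff G g g' \<in> S \<or> group_diff G g' g \<in> S)})"


definition real_add_group :: "real monoid" where
  "real_add_group = \<lparr>carrier = UNIV, monoid.mult = (+), one = 0\<rparr>"

definition circle_group :: "real set monoid" where
  "circle_group = real_add_group Mod \<int>"

definition torus_group :: "nat \<Rightarrow> (nat \<Rightarrow> real set) monoid" where
  "torus_group d = product_group {..<d} (\<lambda>_. circle_group)"

text \<open>An element of the circle is a coset of the integers, so the distance of any of its
  representatives to the nearest integer is the least modulus of its representatives.\<close>

definition circle_norm :: "real set \<Rightarrow> real" where
  "circle_norm C = (INF y\<in>C. \<bar>y\<bar>)"

text \<open>The inserted 0 only matters for the trivial torus, where d = 0.\<close>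

definition torus_norm :: "nat \<Rightarrow> (nat \<Rightarrow> real set) \<Rightarrow> real" where
  "torus_norm d x = Max (insert 0 ((\<lambda>j. circle_norm (x j)) ` {..<d}))"

lemma coset_Ints: "\<int> #>\<^bsub>real_add_group\<^esub> x = range (\<lambda>n. x - of_int n)"
proof (intro Set.set_eqI iffI)
  fix y assume "y \<in> \<int> #>\<^bsub>real_add_group\<^esub> x"
  then obtain n where "y = of_int n + x"
    by (auto simp: r_coset_def real_add_group_def Ints_def)
  then have "y = x - of_int (- n)" by simp
  then show "y \<in> range (\<lambda>n. x - of_int n)" by blast
next
  fix y assume "y \<in> range (\<lambda>n. x - of_int n)"
  then obtain n where "y = of_int (- n) + x" by auto
  then show "y \<in> \<int> #>\<^bsub>real_add_group\<^esub> x"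
    unfolding r_coset_def real_add_group_def using Ints_of_int[of "- n"] by auto
qed

lemma circle_norm_coset:
  "circle_norm (\<int> #>\<^bsub>real_add_group\<^esub> x) = (INF n. \<bar>x - of_int n\<bar>)"
  by (simp add: circle_norm_def coset_Ints image_image)

lemma circle_norm_coset_attained:
  "circle_norm (\<int> #>\<^bsub>real_add_group\<^esub> x) = \<bar>x - of_int (round x)\<bar>"
  unfolding circle_norm_coset
proof (rule cInf_eq_minimum)
  show "\<bar>x - of_int (round x)\<bar> \<in> range (\<lambda>n. \<bar>x - of_int n\<bar>)" by blast
  fix y assume "y \<in> range (\<lambda>n. \<bar>x - of_int n\<bar>)"
  then show "\<bar>x - of_int (round x)\<bar> \<le> y"
    using round_diff_minimal by auto
qed

definition bohr_recurrent :: "('a, 'b) monoid_scheme \<Rightarrow> 'a set \<Rightarrow> bool" where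
  "bohr_recurrent G S \<longleftrightarrow>
     (\<forall>d. \<forall>\<rho>\<in>hom G (torus_group d). \<forall>\<epsilon>>0. \<exists>s\<in>S. torus_norm d (\<rho> s) < \<epsilon>)"

definition chromatically_recurrent :: "('a, 'b) monoid_scheme \<Rightarrow> 'a set \<Rightarrow> bool" where
  "chromatically_recurrent G S \<longleftrightarrow>
     (\<forall>r::nat. \<forall>f\<in>carrier G \<rightarrow> {1..r}.
        \<exists>a\<in>carrier G. \<exists>b\<in>carrier G. f a = f b \<and> group_diff G b a \<in> S)"


definition Fp_omega :: "nat \<Rightarrow> (nat \<Rightarrow> int) monoid" where
  "Fp_omega p = sum_group UNIV (\<lambda>_. integer_mod_group p)"

definition basis_vec :: "nat \<Rightarrow> nat \<Rightarrow> int" where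
  "basis_vec i = (\<lambda>j. if j = i then 1 else 0)"

definition basis_sum :: "nat \<Rightarrow> nat set \<Rightarrow> nat \<Rightarrow> int" where
  "basis_sum p F = finprod (Fp_omega p) basis_vec F"

definition edge_vectors :: "nat \<Rightarrow> nat set set \<Rightarrow> (nat \<Rightarrow> int) set" where
  "edge_vectors p \<F> = basis_sum p ` \<F>"

lemma comm_group_Fp_omega: "comm_group (Fp_omega p)"
proof -
  interpret group "Fp_omega p" by (simp add: Fp_omega_def)
  show ?thesis
    by unfold_locales (auto simp: Fp_omega_def add.commute)
qed

lemma carrier_Fp_omega:
  "p > 0 \<Longrightarrow> carrier (Fp_omega p) = {x. (\<forall>i. 0 \<le> x i \<and> x i < int p) \<and> finite {i. x i \<noteq> 0}}"
  by (auto simp: Fp_omega_def carrier_sum_group carrier_integer_mod_group PiE_iff)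

lemma basis_vec_in_Fp_omega: "p > 1 \<Longrightarrow> basis_vec i \<in> carrier (Fp_omega p)"
  by (auto simp: carrier_Fp_omega basis_vec_def)

lemma basis_sum_eq:
  assumes "p > 1" "finite F"
  shows "basis_sum p F = (\<lambda>i. if i \<in> F then 1 else 0)"
proof -
  interpret comm_group "Fp_omega p" by (rule comm_group_Fp_omega)
  show ?thesis using assms(2)
  proof (induction F)
    case empty
    then show ?case by (simp add: basis_sum_def) (simp add: Fp_omega_def)
  next
    case (insert k F)
    have "basis_sum p (insert k F) = basis_vec k \<otimes>\<^bsub>Fp_omega p\<^esub> basis_sum p F"
      using insert.hyps basis_vec_in_Fp_omega[OF assms(1)]
      by (simp add: basis_sum_def)
    also have "\<dots> = (\<lambda>i. if i \<in> insert k F then 1 else 0)"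
      unfolding insert.IH using insert.hyps assms(1)
      by (auto simp: Fp_omega_def basis_vec_def)
    finally show ?case .
  qed
qed

end

(* (b) implies (a): if F is p-uniform with infinite chromatic number and rho maps into a torus,
   colour n by rho(e_n), which takes finitely many values as it is p-torsion. A monochromatic
   edge F gives rho(e_F) = p rho(e_n) = 0, so E(F) is Bohr recurrent.

   (a) implies (b): given a Bohr recurrent S, let (g_n) list every element of the group infinitely
   often, and let the edges be the p-sets F with sum_{n in F} g_n in S. The homomorphism
   e_n -> g_n maps E(F) into S, so colourings pull back, and it remains to see that the hypergraph
   has infinite chromatic number. A colouring of the vertices yields a colouring of the group
   such that any monochromatic x, y, z with x + y - 2z = x + y + (p-2)z in S span a monochromatic
   edge. So it suffices that for every finite colouring of F_p^omega the monochromatic values of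
   x + y - 2z cover a subgroup of finite index (cf. Bogolyubov, Bergelson and Ruzsa). In F_p^n, a
   van der Waerden argument (colour focusing) averaged over random affine maps produces a positive
   proportion of monochromatic solutions of x + y - 2z = 0, and on the annihilator of the large
   Fourier spectrum of the colour classes the number of solutions of x + y - 2z = h hardly depends
   on h. The codimension is bounded independently of n, so compactness gives the result for
   F_p^omega. *)
theory Submission
  imports
    Defs
    "HOL-Library.Function_Algebras"
    "HOL-Library.Diagonal_Subsequence"
    "HOL-Library.Countable_Set"
    "HOL-Library.Nat_Bijection"
begin

section \<open>Colour focusing for three-term progressions\<close>

text \<open>The range of the entries is forced by the focusing step, which moves the focus from
  f to f - w + 2w' for two new basis vectors w and w'.\<close>

definition ap_box :: "nat \<Rightarrow> (nat \<Rightarrow> int) set" where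
  "ap_box m = {t. (\<forall>i. t i \<in> {-1..2}) \<and> (\<forall>i\<ge>m. t i = 0)}"

lemma finite_ap_box: "finite (ap_box m)"
proof -
  have "ap_box m \<subseteq> {t. \<forall>i. (i \<in> {..<m} \<longrightarrow> t i \<in> {-1..2}) \<and> (i \<notin> {..<m} \<longrightarrow> t i = 0)}"
    by (auto simp: ap_box_def)
  moreover have "finite {t. \<forall>i. (i \<in> {..<m} \<longrightarrow> t i \<in> {-1..2::int}) \<and> (i \<notin> {..<m} \<longrightarrow> t i = 0)}"
    by (rule finite_set_of_finite_funs) auto
  ultimately show ?thesis by (rule finite_subset)
qed

text \<open>A coefficient 1 or -1 makes an integer combination of independent uniform elements of a
  finite group uniform, whatever the group.\<close>

definition unit_entry :: "(nat \<Rightarrow> int) \<Rightarrow> bool" where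
  "unit_entry d \<longleftrightarrow> (\<exists>k. d k = 1 \<or> d k = -1)"

text \<open>The pair \<open>(a, a + d)\<close> determines the progression and ranges over a finite
  set of patterns independent of the colouring; the counting argument later sums over these
  patterns.\<close>

definition mono_ap :: "((nat \<Rightarrow> int) \<Rightarrow> nat) \<Rightarrow> nat \<Rightarrow> bool" where
  "mono_ap c m \<longleftrightarrow> (\<exists>a d. a \<in> ap_box m \<and> a + d \<in> ap_box m \<and> unit_entry d \<and>
     c (a + d) = c a \<and> c (a + d + d) = c a)"

lemma mono_apI:
  assumes "a \<in> ap_box m" "a + d \<in> ap_box m" "unit_entry d" "c (a + d) = c a" "c (a + d + d) = c a"
  shows "mono_ap c m"
  using assms unfolding mono_ap_def by blast

text \<open>The progressions \<open>f - d - d\<close>, \<open>f - d\<close>, \<open>f\<close> are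
  spokes with the common last term \<open>f\<close>, the focus. Spokes are counted by the number of
  colours they use, so \<open>D\<close> may contain several of one colour.\<close>

definition focused :: "((nat \<Rightarrow> int) \<Rightarrow> nat) \<Rightarrow> nat \<Rightarrow> nat \<Rightarrow> bool" where
  "focused c m s \<longleftrightarrow> (\<exists>f D. f \<in> ap_box m \<and>
     (\<forall>d\<in>D. f - d - d \<in> ap_box m \<and> f - d \<in> ap_box m \<and> unit_entry d \<and> c (f - d - d) = c (f - d)) \<and>
     card ((\<lambda>d. c (f - d)) ` D) = s)"

lemma ap_box_add_basis:
  assumes "b \<in> ap_box m" "i < M" "j < M"  "i \<noteq> j"
  shows "b + basis_vec (m + i) \<in> ap_box (m + M)"
    and "b - basis_vec (m + i) + basis_vec (m + j) + basis_vec (m + j) \<in> ap_box (m + M)"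
proof -
  have bm: "b (m + k) = 0" for k using assms(1) by (auto simp: ap_box_def)
  have bi: "- 1 \<le> b k" "b k \<le> 2" for k using assms(1) by (auto simp: ap_box_def)
  show "b + basis_vec (m + i) \<in> ap_box (m + M)"
    using assms bm[of i] bi by (auto simp: ap_box_def basis_vec_def)
  show "b - basis_vec (m + i) + basis_vec (m + j) + basis_vec (m + j) \<in> ap_box (m + M)"
    using assms bm[of i] bm[of j] bi by (auto simp: ap_box_def basis_vec_def)
qed

text \<open>Among enough shifts by new basis vectors two induce the same colouring of the old box,
  so a configuration focused at \<open>f\<close> occurs twice with equal colours. If the focus has
  the colour of a spoke, a progression is complete. Otherwise moving the focus to
  \<open>f - w i + w j + w j\<close> turns every spoke \<open>d\<close> into \<open>d + E\<close>
  with \<open>E = w j - w i\<close>, and \<open>E\<close> itself becomes a spoke of the new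
  colour.\<close>

lemma colour_focusing:
  "\<exists>m. \<forall>c. range c \<subseteq> {..<r} \<longrightarrow> mono_ap c m \<or> focused c m s"
proof (induction s)
  case 0
  have "focused c 0 0" for c
    unfolding focused_def by (rule exI[of _ 0], rule exI[of _ "{}"]) (auto simp: ap_box_def)
  then show ?case by blast
next
  case (Suc s)
  then obtain m where m: "\<And>c. range c \<subseteq> {..<r} \<Longrightarrow> mono_ap c m \<or> focused c m s" by blast
  define X where "X = PiE (ap_box m) (\<lambda>_. {..<r})"
  have finX: "finite X" unfolding X_def by (intro finite_PiE finite_ap_box) auto
  \<comment> \<open>One shift more than there are colourings of the box by \<open>r\<close>
    colours.\<close>
  define M where "M = Suc (card X)"
  have "mono_ap c (m + M) \<or> focused c (m + M) (Suc s)" if c: "range c \<subseteq> {..<r}" for c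
  proof -
    define w where "w j = basis_vec (m + j)" for j
    define fib where "fib = (\<lambda>j. restrict (\<lambda>t. c (t + w j)) (ap_box m))"
    have "c t < r" for t using c by auto
    then have "fib ` {..<M} \<subseteq> X" by (auto simp: fib_def X_def)
    then have "card (fib ` {..<M}) < card {..<M}"
      using card_mono[OF finX, of "fib ` {..<M}"] by (simp add: M_def)
    then have "\<not> inj_on fib {..<M}" using pigeonhole by blast
    then obtain i j where ij: "i < M" "j < M" "i \<noteq> j" "fib i = fib j"
      by (auto simp: inj_on_def)
    have same: "c (t + w i) = c (t + w j)" if "t \<in> ap_box m" for t
      using fun_cong[OF ij(4), of t] that by (simp add: fib_def)
    note box = ap_box_add_basis[where m = m, OF _ ij(1,2,3), folded w_def] 
       ap_box_add_basis(1)[where m = m, OF _ ij(2,1) ij(3)[symmetric], folded w_def]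
    have "range (\<lambda>t. c (t + w i)) \<subseteq> {..<r}" using c by auto
    from m[OF this] show ?thesis
    proof
      assume "mono_ap (\<lambda>t. c (t + w i)) m"
      then obtain a d where ad: "a \<in> ap_box m" "a + d \<in> ap_box m" "unit_entry d"
         "c (a + d + w i) = c (a + w i)" "c (a + d + d + w i) = c (a + w i)"
        unfolding mono_ap_def by blast
      have "mono_ap c (m + M)"
        using ad box(1)[OF ad(1)] box(1)[OF ad(2)]
        by (intro mono_apI[of "a + w i" _ d]) (simp_all add: ac_simps)
      then show ?thesis ..
    next
      assume "focused (\<lambda>t. c (t + w i)) m s"
      then obtain f D where f: "f \<in> ap_box m" and
        D: "\<And>d. d \<in> D \<Longrightarrow> f - d - d \<in> ap_box m \<and> f - d \<in> ap_box m \<and> unit_entry d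
              \<and> c (f - d - d + w i) = c (f - d + w i)"
        and card: "card ((\<lambda>d. c (f - d + w i)) ` D) = s"
        unfolding focused_def by blast
      show ?thesis
      proof (cases "c (f + w i) \<in> (\<lambda>d. c (f - d + w i)) ` D")
        case True
        then obtain d where d: "d \<in> D" "c (f + w i) = c (f - d + w i)" by blast
        have "mono_ap c (m + M)"
          using d D[OF d(1)] box(1)[of "f - d - d"] box(1)[of "f - d"]
          by (intro mono_apI[of "f - d - d + w i" _ d]) (simp_all add: algebra_simps)
        then show ?thesis ..
      next
        case False
        define E where "E = w j - w i"
        define f' where "f' = f - w i + w j + w j"
        have shift: "f' - (d + E) = f - d + w j" "f - d + w j - (d + E) = f - d - d + w i"
          "f' - E = f + w j" "f + w j - E = f + w i" for d
          by (simp_all add: f'_def E_def algebra_simps)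
        \<comment> \<open>At the new coordinate \<open>m + j\<close> every old \<open>d\<close>
          vanishes, because \<open>f\<close> and \<open>f - d\<close> do; hence both
          \<open>E\<close> and \<open>d + E\<close> have entry 1 there.\<close>
        have E: "E (m + j) = 1" "d \<in> D \<Longrightarrow> d (m + j) = 0" for d
        proof -
          show "E (m + j) = 1" using ij(3) by (simp add: E_def w_def basis_vec_def)
          assume "d \<in> D"
          then have "f - d \<in> ap_box m" using D by blast
          then have "(f - d) (m + j) = 0" "f (m + j) = 0" using f unfolding ap_box_def by auto
          then show "d (m + j) = 0" by simp
        qed
        define D' where "D' = insert E ((\<lambda>d. d + E) ` D)"
        have 1: "f' \<in> ap_box (m + M)" unfolding f'_def by (rule box(2)[OF f])
        have 2: "\<forall>d\<in>D'. f' - d - d \<in> ap_box (m + M) \<and> f' - d \<in> ap_box (m + M) \<and> unit_entry d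
            \<and> c (f' - d - d) = c (f' - d)"
        proof
          fix d' assume "d' \<in> D'"
          then consider "d' = E" | d where "d \<in> D" "d' = d + E" unfolding D'_def by blast
          then show "f' - d' - d' \<in> ap_box (m + M) \<and> f' - d' \<in> ap_box (m + M) \<and> unit_entry d'
            \<and> c (f' - d' - d') = c (f' - d')"
          proof cases
            case 1
            have "unit_entry E" using E(1) unfolding unit_entry_def by blast
            then show ?thesis unfolding 1 shift using box f same by simp
          next
            case 2
            have "(d + E) (m + j) = 1" using E 2 by simp
            then have "unit_entry (d + E)" unfolding unit_entry_def by blast
            then show ?thesis unfolding 2 shift using box D[OF 2(1)] same[of "f - d"] by simp
          qed
        qed
        have "(\<lambda>d. c (f' - d)) ` D' = insert (c (f + w j)) ((\<lambda>d. c (f - d + w j)) ` D)"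
          unfolding D'_def by (simp add: shift image_image)
        also have "\<dots> = insert (c (f + w i)) ((\<lambda>d. c (f - d + w i)) ` D)"
          using same f D by (metis (mono_tags, lifting) image_cong)
        finally have img: "(\<lambda>d. c (f' - d)) ` D' =
          insert (c (f + w i)) ((\<lambda>d. c (f - d + w i)) ` D)" .
        have "finite ((\<lambda>d. c (f - d + w i)) ` D)"
          by (rule finite_subset[of _ "{..<r}"]) (use c in auto)
        then have "card ((\<lambda>d. c (f' - d)) ` D') = Suc s"
          using False card unfolding img by simp
        then have "focused c (m + M) (Suc s)" unfolding focused_def using 1 2 by blast
        then show ?thesis ..
      qed
    qed
  qed
  then show ?case by blast
qed

text \<open>Spokes in \<open>Suc r\<close> colours cannot occur among \<open>r\<close> colours, so
  only the first alternative of colour focusing remains.\<close>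

lemma van_der_waerden_3:
  "\<exists>m. \<forall>c. range c \<subseteq> {..<r} \<longrightarrow> mono_ap c m"
proof -
  obtain m where m: "\<And>c. range c \<subseteq> {..<r} \<Longrightarrow> mono_ap c m \<or> focused c m (Suc r)"
    using colour_focusing by blast
  have "\<not> focused c m (Suc r)" if "range c \<subseteq> {..<r}" for c
  proof
    assume "focused c m (Suc r)"
    then obtain f D where "card ((\<lambda>d. c (f - d)) ` D) = Suc r" unfolding focused_def by blast
    moreover have "card ((\<lambda>d. c (f - d)) ` D) \<le> card {..<r}"
      by (rule card_mono) (use that in auto)
    ultimately show False by simp
  qed
  then show ?thesis using m by blast
qed

section \<open>Counting monochromatic progressions modulo p\<close>

text \<open>A function on the n-th power of the integers modulo p is modelled as a periodic function of
  integer vectors; vecs p n is the set of representatives over which such functions are summed.\<close>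

definition vecs :: "nat \<Rightarrow> nat \<Rightarrow> (nat \<Rightarrow> int) set" where
  "vecs p n = {x. \<forall>i. (i \<in> {..<n} \<longrightarrow> x i \<in> {0..<int p}) \<and> (i \<notin> {..<n} \<longrightarrow> x i = 0)}"

definition reduce_vec :: "nat \<Rightarrow> nat \<Rightarrow> (nat \<Rightarrow> int) \<Rightarrow> nat \<Rightarrow> int" where
  "reduce_vec p n x = (\<lambda>i. if i < n then x i mod int p else 0)"

definition periodic :: "nat \<Rightarrow> nat \<Rightarrow> ((nat \<Rightarrow> int) \<Rightarrow> 'a) \<Rightarrow> bool" where
  "periodic p n \<phi> \<longleftrightarrow> (\<forall>x y. (\<forall>i<n. x i mod int p = y i mod int p) \<longrightarrow> \<phi> x = \<phi> y)"

lemma periodicD: "periodic p n \<phi> \<Longrightarrow> (\<And>i. i < n \<Longrightarrow> x i mod int p = y i mod int p) \<Longrightarrow> \<phi> x = \<phi> y"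
  unfolding periodic_def by blast

lemma periodic_reduce_vec: "periodic p n \<phi> \<Longrightarrow> \<phi> (reduce_vec p n x) = \<phi> x"
  by (rule periodicD) (auto simp: reduce_vec_def)

lemma finite_vecs [simp]: "finite (vecs p n)"
  unfolding vecs_def by (rule finite_set_of_finite_funs) auto

lemma zero_in_vecs: "p > 0 \<Longrightarrow> 0 \<in> vecs p n"
  by (auto simp: vecs_def)

lemma card_vecs_pos: "p > 0 \<Longrightarrow> card (vecs p n) > 0"
  using zero_in_vecs card_gt_0_iff finite_vecs by blast

lemma reduce_vec_in_vecs: "p > 0 \<Longrightarrow> reduce_vec p n x \<in> vecs p n"
  by (auto simp: vecs_def reduce_vec_def)

lemma reduce_vec_id: "x \<in> vecs p n \<Longrightarrow> reduce_vec p n x = x"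
  by (auto simp: vecs_def reduce_vec_def)

lemma reduce_vec_mod_eq: "reduce_vec p n x = reduce_vec p n y \<longleftrightarrow> (\<forall>i<n. x i mod int p = y i mod int p)"
  by (auto simp: reduce_vec_def fun_eq_iff)

lemma reduce_vec_eqI:
  "y \<in> vecs p n \<Longrightarrow> (\<And>i. i < n \<Longrightarrow> x i mod int p = y i mod int p) \<Longrightarrow> reduce_vec p n x = y"
  by (metis reduce_vec_id reduce_vec_mod_eq)

lemma reduce_vec_nth: "i < n \<Longrightarrow> reduce_vec p n x i = x i mod int p"
  by (simp add: reduce_vec_def)

section \<open>Changes of variable and random linear maps\<close>

lemma sum_vecs_translate:
  assumes "p > 0" "periodic p n \<phi>"
  shows "(\<Sum>x\<in>vecs p n. \<phi> (x + t)) = (\<Sum>x\<in>vecs p n. \<phi> x)"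
proof (rule sum.reindex_bij_witness[where i = "\<lambda>x. reduce_vec p n (x - t)" and j = "\<lambda>x. reduce_vec p n (x + t)"])
  fix x assume x: "x \<in> vecs p n"
  show "reduce_vec p n (reduce_vec p n (x + t) - t) = x"
    by (rule reduce_vec_eqI[OF x]) (simp add: reduce_vec_nth mod_simps)
  show "reduce_vec p n (reduce_vec p n (x - t) + t) = x"
    by (rule reduce_vec_eqI[OF x]) (simp add: reduce_vec_nth mod_simps)
qed (use assms in \<open>auto simp: reduce_vec_in_vecs periodic_reduce_vec\<close>)

lemma sum_vecs_reflect:
  assumes "p > 0" "periodic p n \<phi>"
  shows "(\<Sum>x\<in>vecs p n. \<phi> (t - x)) = (\<Sum>x\<in>vecs p n. \<phi> x)"
proof (rule sum.reindex_bij_witness[where i = "\<lambda>x. reduce_vec p n (t - x)" and j = "\<lambda>x. reduce_vec p n (t - x)"])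
  fix x assume x: "x \<in> vecs p n"
  show "reduce_vec p n (t - reduce_vec p n (t - x)) = x"
    by (rule reduce_vec_eqI[OF x]) (simp add: reduce_vec_nth mod_simps)
  then show "reduce_vec p n (t - reduce_vec p n (t - x)) = x" .
qed (use assms in \<open>auto simp: reduce_vec_in_vecs periodic_reduce_vec\<close>)

text \<open>The value at \<open>a\<close> of the linear map sending the basis vector
  \<open>j < m\<close> to \<open>v j\<close>; a random \<open>v\<close> gives a random linear image
  of the integer box.\<close>

definition lincomb :: "nat \<Rightarrow> (nat \<Rightarrow> int) \<Rightarrow> (nat \<Rightarrow> nat \<Rightarrow> int) \<Rightarrow> nat \<Rightarrow> int" where
  "lincomb m a v = (\<lambda>i. \<Sum>j<m. a j * v j i)"

lemma lincomb_add: "lincomb m (a + b) v = lincomb m a v + lincomb m b v"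
  by (simp add: lincomb_def fun_eq_iff sum.distrib algebra_simps)

lemma lincomb_upd:
  assumes "k < m"
  shows "lincomb m a (v(k := y)) i = lincomb m a v i + a k * (y i - v k i)"
proof -
  have "lincomb m a (v(k := y)) i - lincomb m a v i = (\<Sum>j<m. if j = k then a k * (y i - v k i) else 0)"
    unfolding lincomb_def sum_subtractf[symmetric] by (rule sum.cong) (auto simp: algebra_simps)
  also have "\<dots> = a k * (y i - v k i)" using assms by simp
  finally show ?thesis by simp
qed

text \<open>Replacing \<open>v k\<close> by \<open>v k - t\<close> permutes \<open>W\<close> and
  moves the combination by \<open>- a k * t\<close> modulo \<open>p\<close>. When one averages over
  \<open>t\<close> as well, a coefficient 1 or -1 makes the argument run uniformly through the whole
  group.\<close>

lemma sum_lincomb_uniform: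
  fixes \<phi> :: "(nat \<Rightarrow> int) \<Rightarrow> real"
  assumes p: "p > 0" and \<phi>: "periodic p n \<phi>" and k: "k < m" "a k = 1 \<or> a k = -1"
  defines "W \<equiv> PiE {..<m} (\<lambda>_. vecs p n)"
  shows "card (vecs p n) * (\<Sum>v\<in>W. \<phi> (lincomb m a v)) = card W * (\<Sum>x\<in>vecs p n. \<phi> x)"
proof -
  have upd: "v(k := reduce_vec p n x) \<in> W" if "v \<in> W" for v x
    using that k(1) reduce_vec_in_vecs[OF p] by (auto simp: W_def PiE_iff extensional_def)
  have step: "(\<Sum>v\<in>W. \<phi> (lincomb m a v)) = (\<Sum>v\<in>W. \<phi> (lincomb m a v + (\<lambda>i. a k * t i)))" for t
  proof (rule sum.reindex_bij_witness[where j = "\<lambda>v. v(k := reduce_vec p n (v k - t))"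
        and i = "\<lambda>v. v(k := reduce_vec p n (v k + t))"])
    fix v assume v: "v \<in> W"
    then have vk: "v k \<in> vecs p n" using k by (auto simp: W_def)
    have "reduce_vec p n (reduce_vec p n (v k - t) + t) = v k"
      by (rule reduce_vec_eqI[OF vk]) (simp add: reduce_vec_nth mod_simps)
    then show "(v(k := reduce_vec p n (v k - t)))(k := reduce_vec p n ((v(k := reduce_vec p n (v k - t))) k + t)) = v"
      by simp
    have "reduce_vec p n (reduce_vec p n (v k + t) - t) = v k"
      by (rule reduce_vec_eqI[OF vk]) (simp add: reduce_vec_nth mod_simps)
    then show "(v(k := reduce_vec p n (v k + t)))(k := reduce_vec p n ((v(k := reduce_vec p n (v k + t))) k - t)) = v"
      by simp
    show "\<phi> (lincomb m a (v(k := reduce_vec p n (v k - t))) + (\<lambda>i. a k * t i)) = \<phi> (lincomb m a v)"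
    proof (rule periodicD[OF \<phi>])
      fix i assume "i < n"
      \<comment> \<open>Reducing \<open>v k - t\<close> modulo \<open>p\<close> changes the
        combination by a multiple of \<open>p\<close>, which \<open>\<phi>\<close> ignores.\<close>
      have mod: "(v k i - t i) mod int p = v k i - t i - int p * ((v k i - t i) div int p)"
        by (simp add: minus_mult_div_eq_mod)
      have "lincomb m a v i + a k * ((v k i - t i) mod int p - v k i) + a k * t i
          = lincomb m a v i + int p * (- a k * ((v k i - t i) div int p))"
        by (subst mod) (simp add: algebra_simps)
      then have "(lincomb m a v i + a k * ((v k i - t i) mod int p - v k i) + a k * t i) mod int p
          = lincomb m a v i mod int p"
        by (metis mod_mult_self2)
      then show "(lincomb m a (v(k := reduce_vec p n (v k - t))) + (\<lambda>i. a k * t i)) i mod int p =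
         lincomb m a v i mod int p"
        using \<open>i < n\<close> by (simp add: lincomb_upd[OF k(1)] reduce_vec_nth)
    qed
  qed (use upd in auto)
  have "(\<Sum>t\<in>vecs p n. \<phi> (x + (\<lambda>i. a k * t i))) = (\<Sum>t\<in>vecs p n. \<phi> t)" for x
  proof -
    show ?thesis using k(2)
    proof
      assume "a k = 1"
      then have "x + (\<lambda>i. a k * t i) = t + x" for t by (simp add: fun_eq_iff)
      then show ?thesis using sum_vecs_translate[OF p \<phi>, of x] by (simp add: add.commute)
    next
      assume "a k = -1"
      then have "x + (\<lambda>i. a k * t i) = x - t" for t by (simp add: fun_eq_iff)
      then show ?thesis using sum_vecs_reflect[OF p \<phi>, of x] by simp
    qed
  qed
  then have "card W * (\<Sum>x\<in>vecs p n. \<phi> x) = (\<Sum>v\<in>W. \<Sum>t\<in>vecs p n. \<phi> (lincomb m a v + (\<lambda>i. a k * t i)))"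
    by simp
  also have "\<dots> = (\<Sum>t\<in>vecs p n. \<Sum>v\<in>W. \<phi> (lincomb m a v))"
    by (subst sum.swap) (simp add: step[symmetric])
  finally show ?thesis by simp
qed

section \<open>Supersaturation of monochromatic progressions\<close>

definition ap_indicator :: "((nat \<Rightarrow> int) \<Rightarrow> nat) \<Rightarrow> (nat \<Rightarrow> int) \<Rightarrow> (nat \<Rightarrow> int) \<Rightarrow> real" where
  "ap_indicator c x d = of_bool (c (x + d) = c x \<and> c (x + d + d) = c x)"

lemma ap_indicator_periodic:
  assumes "periodic p n c"
  shows "periodic p n (\<lambda>x. ap_indicator c x d)" "periodic p n (ap_indicator c x)"
proof -
  have *: "ap_indicator c x d = ap_indicator c x' d'" if "\<And>i. i < n \<Longrightarrow> x i mod int p = x' i mod int p"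
    "\<And>i. i < n \<Longrightarrow> d i mod int p = d' i mod int p" for x x' d d'
  proof -
    have "c x = c x'" by (rule periodicD[OF assms]) (rule that)
    moreover have "c (x + d) = c (x' + d')"
      by (rule periodicD[OF assms], unfold plus_fun_apply, intro mod_add_cong that)
    moreover have "c (x + d + d) = c (x' + d' + d')"
      by (rule periodicD[OF assms], unfold plus_fun_apply, intro mod_add_cong that)
    ultimately show ?thesis by (simp add: ap_indicator_def)
  qed
  show "periodic p n (\<lambda>x. ap_indicator c x d)" "periodic p n (ap_indicator c x)"
    unfolding periodic_def by (auto intro!: *)
qed

text \<open>Varnavides averaging. Pulling \<open>c\<close> back along the affine map given by
  \<open>u\<close> and \<open>v\<close> yields a pattern from \<open>Q\<close> by van der Waerden,
  while for a fixed pattern and random \<open>u\<close>, \<open>v\<close> the first term and the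
  difference are independent and uniform. So monochromatic progressions have density at least
  \<open>1 / card Q\<close>, and \<open>Q\<close> is built from \<open>r\<close> alone.\<close>

lemma ap_count_lower_bound:
  "\<exists>q>0. \<forall>p n c. p > 0 \<longrightarrow> periodic p n c \<longrightarrow> range c \<subseteq> {..<r} \<longrightarrow>
     (real (card (vecs p n)))\<^sup>2 \<le> real q * (\<Sum>x\<in>vecs p n. \<Sum>d\<in>vecs p n. ap_indicator c x d)"
proof -
  obtain m where m: "\<And>c. range c \<subseteq> {..<r} \<Longrightarrow> mono_ap c m" using van_der_waerden_3 by blast
  define Q where "Q = {(a, b). a \<in> ap_box m \<and> b \<in> ap_box m \<and> unit_entry (b - a)}"
  have finQ: "finite Q"
    by (rule finite_subset[of _ "ap_box m \<times> ap_box m"]) (auto simp: Q_def finite_ap_box)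
  have main: "(real (card (vecs p n)))\<^sup>2 \<le> card Q * (\<Sum>x\<in>vecs p n. \<Sum>d\<in>vecs p n. ap_indicator c x d)"
    if p: "p > 0" and c: "periodic p n c" and r: "range c \<subseteq> {..<r}" for p n c
  proof -
    define V where "V = vecs p n"
    define W where "W = PiE {..<m} (\<lambda>_. V)"
    define A where "A = ap_indicator c"
    have A0: "A x d \<ge> 0" for x d by (simp add: A_def ap_indicator_def)
    have finW: "finite W" unfolding W_def V_def by (rule finite_PiE) auto
    have "(\<lambda>_\<in>{..<m}. 0) \<in> W" using zero_in_vecs[OF p] by (auto simp: W_def V_def)
    then have Wpos: "card W > 0" using finW card_gt_0_iff by blast
    have cover: "1 \<le> (\<Sum>(a, b)\<in>Q. A (u + lincomb m a v) (lincomb m (b - a) v))" for u v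
    proof -
      have "mono_ap (\<lambda>t. c (u + lincomb m t v)) m" by (rule m) (use r in auto)
      then obtain a d where ad: "a \<in> ap_box m" "a + d \<in> ap_box m" "unit_entry d"
        "c (u + lincomb m (a + d) v) = c (u + lincomb m a v)"
        "c (u + lincomb m (a + d + d) v) = c (u + lincomb m a v)"
        unfolding mono_ap_def by blast
      have "(a, a + d) \<in> Q" using ad by (simp add: Q_def)
      have "A (u + lincomb m a v) (lincomb m d v) = 1"
        using ad(4,5) unfolding A_def ap_indicator_def lincomb_add add.assoc[symmetric] by simp
      then have "1 = (\<Sum>(a, b)\<in>{(a, a + d)}. A (u + lincomb m a v) (lincomb m (b - a) v))" by simp
      also have "\<dots> \<le> (\<Sum>(a, b)\<in>Q. A (u + lincomb m a v) (lincomb m (b - a) v))"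
        by (rule sum_mono2) (use finQ \<open>(a, a + d) \<in> Q\<close> A0 in auto)
      finally show ?thesis .
    qed
    have each: "card V * (\<Sum>v\<in>W. \<Sum>u\<in>V. A (u + lincomb m a v) (lincomb m (b - a) v))
        = card W * (\<Sum>x\<in>V. \<Sum>d\<in>V. A x d)" if "(a, b) \<in> Q" for a b
    proof -
      have ab: "a \<in> ap_box m" "b \<in> ap_box m" "unit_entry (b - a)" using that by (auto simp: Q_def)
      then obtain k where k: "(b - a) k = 1 \<or> (b - a) k = -1" by (auto simp: unit_entry_def)
      have km: "k < m"
      proof (rule ccontr)
        assume "\<not> k < m"
        then have "a k = 0" "b k = 0" using ab(1,2) by (auto simp: ap_box_def)
        then show False using k by simp
      qed
      \<comment> \<open>For fixed \<open>v\<close>, summing over \<open>u\<close> makes the first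
        term uniform; summing over \<open>v\<close> then does the same for the difference, by its
        unit entry.\<close>
      have "(\<Sum>v\<in>W. \<Sum>u\<in>V. A (u + lincomb m a v) (lincomb m (b - a) v))
          = (\<Sum>v\<in>W. \<Sum>u\<in>V. A u (lincomb m (b - a) v))"
        unfolding V_def A_def
        by (intro sum.cong refl sum_vecs_translate[OF p ap_indicator_periodic(1)[OF c]])
      also have "\<dots> = (\<Sum>u\<in>V. \<Sum>v\<in>W. A u (lincomb m (b - a) v))" by (rule sum.swap)
      finally have "card V * (\<Sum>v\<in>W. \<Sum>u\<in>V. A (u + lincomb m a v) (lincomb m (b - a) v))
          = (\<Sum>u\<in>V. card V * (\<Sum>v\<in>W. A u (lincomb m (b - a) v)))"
        by (simp only: sum_distrib_left)
      also have "\<dots> = (\<Sum>u\<in>V. card W * (\<Sum>d\<in>V. A u d))"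
        unfolding V_def W_def A_def
        by (intro sum.cong refl sum_lincomb_uniform[OF p ap_indicator_periodic(2)[OF c] km]) (rule k)
      also have "\<dots> = card W * (\<Sum>x\<in>V. \<Sum>d\<in>V. A x d)" by (simp only: sum_distrib_left)
      finally show ?thesis .
    qed
    have "card V * card W = (\<Sum>v\<in>W. \<Sum>u\<in>V. (1::real))" by simp
    also have "\<dots> \<le> (\<Sum>v\<in>W. \<Sum>u\<in>V. \<Sum>(a, b)\<in>Q. A (u + lincomb m a v) (lincomb m (b - a) v))"
      by (intro sum_mono cover)
    also have "\<dots> = (\<Sum>v\<in>W. \<Sum>ab\<in>Q. \<Sum>u\<in>V. (case ab of (a, b) \<Rightarrow> A (u + lincomb m a v) (lincomb m (b - a) v)))"
      by (intro sum.cong refl sum.swap)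
    also have "\<dots> = (\<Sum>ab\<in>Q. \<Sum>v\<in>W. \<Sum>u\<in>V. (case ab of (a, b) \<Rightarrow> A (u + lincomb m a v) (lincomb m (b - a) v)))"
      by (rule sum.swap)
    finally have "card V * (card V * card W) \<le> card V * (\<Sum>ab\<in>Q. \<Sum>v\<in>W. \<Sum>u\<in>V. (case ab of (a, b) \<Rightarrow> A (u + lincomb m a v) (lincomb m (b - a) v)))"
      by (simp add: mult_left_mono)
    also have "\<dots> = (\<Sum>ab\<in>Q. card W * (\<Sum>x\<in>V. \<Sum>d\<in>V. A x d))"
      unfolding sum_distrib_left[of "real (card V)" _ Q] using each by (intro sum.cong) auto
    also have "\<dots> = card W * (card Q * (\<Sum>x\<in>V. \<Sum>d\<in>V. A x d))" by simp
    finally have "card W * (real (card V))\<^sup>2 \<le> card W * (card Q * (\<Sum>x\<in>V. \<Sum>d\<in>V. A x d))"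
      by (simp add: power2_eq_square mult.commute mult.left_commute)
    then show ?thesis using Wpos by (simp add: V_def A_def)
  qed
  \<comment> \<open>The successor makes the constant positive by construction.\<close>
  have "(real (card (vecs p n)))\<^sup>2 \<le> real (Suc (card Q)) * (\<Sum>x\<in>vecs p n. \<Sum>d\<in>vecs p n. ap_indicator c x d)"
    if "p > 0" "periodic p n c" "range c \<subseteq> {..<r}" for p n c
  proof (rule order_trans[OF main[OF that]])
    show "card Q * (\<Sum>x\<in>vecs p n. \<Sum>d\<in>vecs p n. ap_indicator c x d)
      \<le> Suc (card Q) * (\<Sum>x\<in>vecs p n. \<Sum>d\<in>vecs p n. ap_indicator c x d)"
      by (intro mult_right_mono sum_nonneg) (auto simp: ap_indicator_def)
  qed
  then show ?thesis by blast
qed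

section \<open>Fourier analysis modulo p\<close>

definition unity_root :: "nat \<Rightarrow> int \<Rightarrow> complex" where
  "unity_root p k = cis (2 * pi * of_int k / of_nat p)"

lemma unity_root_add: "unity_root p (a + b) = unity_root p a * unity_root p b"
  by (simp add: unity_root_def cis_mult add_divide_distrib distrib_left)

lemma unity_root_0 [simp]: "unity_root p 0 = 1"
  by (simp add: unity_root_def)

lemma norm_unity_root [simp]: "cmod (unity_root p k) = 1"
  by (simp add: unity_root_def)

lemma cnj_unity_root: "cnj (unity_root p k) = unity_root p (- k)"
  by (simp add: unity_root_def cis_cnj)

lemma unity_root_eq_1_iff:
  assumes "p > 0" shows "unity_root p k = 1 \<longleftrightarrow> int p dvd k"
proof
  assume "int p dvd k"
  then obtain l where "k = int p * l" by blast
  then have "2 * pi * of_int k / of_nat p = 2 * pi * of_int l" using assms by simp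
  then show "unity_root p k = 1" unfolding unity_root_def by (simp add: cis_multiple_2pi)
next
  assume "unity_root p k = 1"
  then have "cos (2 * pi * of_int k / of_nat p) = 1"
    unfolding unity_root_def by (metis cis.sel(1) one_complex.sel(1))
  then obtain l :: int where "2 * pi * of_int k / of_nat p = of_int l * 2 * pi"
    unfolding cos_one_2pi_int by auto
  then have "real_of_int k = real_of_int (l * int p)" using assms by (simp add: field_simps)
  then have "k = l * int p" by (simp only: of_int_eq_iff)
  then show "int p dvd k" by simp
qed

lemma unity_root_cong:
  assumes "p > 0" "int p dvd a - b" shows "unity_root p a = unity_root p b"
proof -
  have "unity_root p a = unity_root p (a - b) * unity_root p b"
    by (simp add: unity_root_add[symmetric])
  then show ?thesis using assms unity_root_eq_1_iff by simp
qed

definition dotp :: "nat \<Rightarrow> (nat \<Rightarrow> int) \<Rightarrow> (nat \<Rightarrow> int) \<Rightarrow> int" where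
  "dotp n \<xi> x = (\<Sum>i<n. \<xi> i * x i)"

lemma dotp_add_left: "dotp n (a + b) x = dotp n a x + dotp n b x"
  and dotp_add: "dotp n x (a + b) = dotp n x a + dotp n x b"
  and dotp_diff: "dotp n x (a - b) = dotp n x a - dotp n x b"
  and dotp_scale_left: "dotp n (\<lambda>i. k * x i) y = k * dotp n x y"
  by (simp_all add: dotp_def sum.distrib sum_subtractf algebra_simps sum_distrib_left)

lemma dotp_basis_vec: "k < n \<Longrightarrow> dotp n (basis_vec k) x = x k"
  by (simp add: dotp_def basis_vec_def if_distrib[of "\<lambda>a. a * _"] cong: if_cong)

lemma dotp_commute: "dotp n x y = dotp n y x"
  by (simp add: dotp_def mult.commute)

lemma periodic_unity_root_dotp:
  assumes "p > 0" shows "periodic p n (\<lambda>x. unity_root p (dotp n \<xi> x))"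
  unfolding periodic_def
proof (intro allI impI unity_root_cong assms)
  fix x y assume "\<forall>i<n. x i mod int p = y i mod int p"
  then have "int p dvd (\<Sum>i<n. \<xi> i * (x i - y i))"
    by (intro dvd_sum dvd_mult) (auto simp: mod_eq_dvd_iff)
  then show "int p dvd dotp n \<xi> x - dotp n \<xi> y"
    by (simp add: dotp_def sum_subtractf algebra_simps)
qed

text \<open>If \<open>p\<close> does not divide \<open>x k\<close>, shifting \<open>\<xi>\<close> by
  \<open>basis_vec k\<close> preserves the sum but also multiplies it by
  \<open>unity_root p (x k)\<close>, which differs from 1.\<close>

lemma unity_root_orthogonality:
  assumes p: "p > 0"
  shows "(\<Sum>\<xi>\<in>vecs p n. unity_root p (dotp n \<xi> x)) =
    (if \<forall>i<n. int p dvd x i then of_nat (card (vecs p n)) else 0)"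
proof (cases "\<forall>i<n. int p dvd x i")
  case True
  then have "int p dvd dotp n \<xi> x" for \<xi> unfolding dotp_def by (intro dvd_sum dvd_mult) auto
  then have "unity_root p (dotp n \<xi> x) = 1" for \<xi> using unity_root_eq_1_iff[OF p] by blast
  then show ?thesis using True by simp
next
  case False
  then obtain k where k: "k < n" "\<not> int p dvd x k" by blast
  define S where "S = (\<Sum>\<xi>\<in>vecs p n. unity_root p (dotp n \<xi> x))"
  have "S = (\<Sum>\<xi>\<in>vecs p n. unity_root p (dotp n (\<xi> + basis_vec k) x))"
    unfolding S_def
    by (rule sum_vecs_translate[OF p, symmetric])
      (use periodic_unity_root_dotp[OF p, of n x] in \<open>simp add: dotp_commute[of n x]\<close>)
  also have "\<dots> = S * unity_root p (x k)"
    unfolding S_def by (simp add: dotp_add_left dotp_basis_vec[OF k(1)] unity_root_add sum_distrib_right)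
  finally have "S = 0" using k(2) unity_root_eq_1_iff[OF p] by auto
  then show ?thesis by (simp only: S_def[symmetric] False if_False)
qed

section \<open>Fourier transform, Parseval and three-term equations\<close>

definition fourier :: "nat \<Rightarrow> nat \<Rightarrow> ((nat \<Rightarrow> int) \<Rightarrow> real) \<Rightarrow> (nat \<Rightarrow> int) \<Rightarrow> complex" where
  "fourier p n f \<xi> = (\<Sum>x\<in>vecs p n. of_real (f x) * unity_root p (- dotp n \<xi> x))"

lemma vecs_eq_iff_dvd:
  assumes "x \<in> vecs p n" "y \<in> vecs p n"
  shows "x = y \<longleftrightarrow> (\<forall>i<n. int p dvd x i - y i)"
  using reduce_vec_mod_eq[of p n x y] assms by (simp add: reduce_vec_id mod_eq_dvd_iff)

text \<open>The dilation is used with \<open>k = -2\<close>, the coefficient of z in x + y - 2z.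
  After the square is expanded, orthogonality keeps the pairs with \<open>k * (y i - x i)\<close>
  divisible by \<open>p\<close> for all \<open>i < n\<close>; as \<open>k\<close> is invertible
  modulo \<open>p\<close>, these are the pairs with \<open>x = y\<close>.\<close>

lemma parseval_dilated:
  fixes f :: "(nat \<Rightarrow> int) \<Rightarrow> real"
  assumes p: "p > 0" and k: "coprime (int p) k"
  shows "(\<Sum>\<xi>\<in>vecs p n. (cmod (fourier p n f (\<lambda>i. k * \<xi> i)))\<^sup>2) = card (vecs p n) * (\<Sum>x\<in>vecs p n. (f x)\<^sup>2)"
proof -
  define V where "V = vecs p n"
  have sq: "of_real ((cmod (fourier p n f (\<lambda>i. k * \<xi> i)))\<^sup>2) =
    (\<Sum>x\<in>V. \<Sum>y\<in>V. of_real (f x * f y) * unity_root p (dotp n \<xi> (\<lambda>i. k * (y i - x i))))" for \<xi>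
  proof -
    have "of_real ((cmod (fourier p n f (\<lambda>i. k * \<xi> i)))\<^sup>2) =
      fourier p n f (\<lambda>i. k * \<xi> i) * cnj (fourier p n f (\<lambda>i. k * \<xi> i))"
      by (rule complex_norm_square)
    also have "\<dots> = (\<Sum>x\<in>V. \<Sum>y\<in>V. (of_real (f x) * unity_root p (- dotp n (\<lambda>i. k * \<xi> i) x)) *
        (of_real (f y) * unity_root p (dotp n (\<lambda>i. k * \<xi> i) y)))"
      by (simp add: fourier_def V_def cnj_unity_root sum_product)
    also have "\<dots> = (\<Sum>x\<in>V. \<Sum>y\<in>V. of_real (f x * f y) *
        unity_root p (- dotp n (\<lambda>i. k * \<xi> i) x + dotp n (\<lambda>i. k * \<xi> i) y))"
      by (simp only: unity_root_add of_real_mult ac_simps)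
    also have "(\<lambda>x y. - dotp n (\<lambda>i. k * \<xi> i) x + dotp n (\<lambda>i. k * \<xi> i) y) =
        (\<lambda>x y. dotp n \<xi> (\<lambda>i. k * (y i - x i)))"
      by (simp add: fun_eq_iff dotp_def sum_subtractf algebra_simps)
    finally show ?thesis by (simp add: fun_eq_iff)
  qed
  have "of_real (\<Sum>\<xi>\<in>V. (cmod (fourier p n f (\<lambda>i. k * \<xi> i)))\<^sup>2) =
    (\<Sum>\<xi>\<in>V. \<Sum>x\<in>V. \<Sum>y\<in>V. of_real (f x * f y) * unity_root p (dotp n \<xi> (\<lambda>i. k * (y i - x i))))"
    unfolding of_real_sum sq ..
  also have "\<dots> = (\<Sum>x\<in>V. \<Sum>\<xi>\<in>V. \<Sum>y\<in>V. of_real (f x * f y) * unity_root p (dotp n \<xi> (\<lambda>i. k * (y i - x i))))"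
    by (rule sum.swap)
  also have "\<dots> = (\<Sum>x\<in>V. \<Sum>y\<in>V. \<Sum>\<xi>\<in>V. of_real (f x * f y) * unity_root p (dotp n \<xi> (\<lambda>i. k * (y i - x i))))"
    by (intro sum.cong refl sum.swap)
  also have "\<dots> = (\<Sum>x\<in>V. \<Sum>y\<in>V. of_real (f x * f y) * (if y = x then of_nat (card V) else 0))"
  proof (intro sum.cong refl)
    fix x y assume "x \<in> V" "y \<in> V"
    then have "(\<forall>i<n. int p dvd k * (y i - x i)) \<longleftrightarrow> y = x"
      using k by (simp add: V_def vecs_eq_iff_dvd coprime_dvd_mult_right_iff)
    then show "(\<Sum>\<xi>\<in>V. of_real (f x * f y) * unity_root p (dotp n \<xi> (\<lambda>i. k * (y i - x i)))) =
      of_real (f x * f y) * (if y = x then of_nat (card V) else 0)"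
      using unity_root_orthogonality[OF p, of n "\<lambda>i. k * (y i - x i)"]
      unfolding sum_distrib_left[symmetric] V_def by simp
  qed
  also have "\<dots> = (\<Sum>x\<in>V. \<Sum>y\<in>V. if y = x then of_real (f x * f x) * of_nat (card V) else 0)"
    by (intro sum.cong refl) auto
  also have "\<dots> = of_real (card V * (\<Sum>x\<in>V. (f x)\<^sup>2))"
    by (simp add: V_def sum_distrib_left power2_eq_square mult.commute)
  finally show ?thesis unfolding V_def of_real_eq_iff .
qed

text \<open>The frequencies \<open>\<xi>\<close>, \<open>-2 * \<xi>\<close>, \<open>\<xi>\<close>
  encode x - 2z + y, so orthogonality keeps exactly the \<open>y\<close> congruent to
  \<open>z + z - x\<close>. The separate \<open>g\<close> leaves room for a difference of translates
  of \<open>f\<close>.\<close>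

lemma fourier_three_term:
  fixes f g :: "(nat \<Rightarrow> int) \<Rightarrow> real"
  assumes p: "p > 0" and g: "periodic p n g"
  shows "(\<Sum>\<xi>\<in>vecs p n. fourier p n f \<xi> * fourier p n f (\<lambda>i. -2 * \<xi> i) * fourier p n g \<xi>) =
    of_real (card (vecs p n) * (\<Sum>x\<in>vecs p n. \<Sum>z\<in>vecs p n. f x * f z * g (z + z - x)))"
proof -
  define V where "V = vecs p n"
  have prod: "fourier p n f \<xi> * fourier p n f (\<lambda>i. -2 * \<xi> i) * fourier p n g \<xi> =
     (\<Sum>x\<in>V. \<Sum>z\<in>V. \<Sum>y\<in>V. of_real (f x * f z * g y) * unity_root p (dotp n \<xi> (z + z - x - y)))" for \<xi>
  proof -
    have "fourier p n f \<xi> * fourier p n f (\<lambda>i. -2 * \<xi> i) * fourier p n g \<xi> =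
      (\<Sum>x\<in>V. \<Sum>z\<in>V. \<Sum>y\<in>V. of_real (f x) * unity_root p (- dotp n \<xi> x) *
        (of_real (f z) * unity_root p (- dotp n (\<lambda>i. -2 * \<xi> i) z)) *
        (of_real (g y) * unity_root p (- dotp n \<xi> y)))"
      unfolding fourier_def V_def sum_product[symmetric] sum_distrib_left[symmetric] sum_distrib_right[symmetric] ..
    also have "\<dots> = (\<Sum>x\<in>V. \<Sum>z\<in>V. \<Sum>y\<in>V. of_real (f x * f z * g y) *
       unity_root p (- dotp n \<xi> x + - dotp n (\<lambda>i. -2 * \<xi> i) z + - dotp n \<xi> y))"
      by (simp only: unity_root_add of_real_mult ac_simps)
    also have "(\<lambda>x z y. - dotp n \<xi> x + - dotp n (\<lambda>i. -2 * \<xi> i) z + - dotp n \<xi> y) =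
       (\<lambda>x z y. dotp n \<xi> (z + z - x - y))"
    proof (intro ext)
      fix x z y
      have "dotp n (\<lambda>i. -2 * \<xi> i) z = -2 * dotp n \<xi> z" by (rule dotp_scale_left)
      then show "- dotp n \<xi> x + - dotp n (\<lambda>i. -2 * \<xi> i) z + - dotp n \<xi> y = dotp n \<xi> (z + z - x - y)"
        unfolding dotp_diff dotp_add by linarith
    qed
    finally show ?thesis by (simp add: fun_eq_iff)
  qed
  have "(\<Sum>\<xi>\<in>V. fourier p n f \<xi> * fourier p n f (\<lambda>i. -2 * \<xi> i) * fourier p n g \<xi>) =
     (\<Sum>\<xi>\<in>V. \<Sum>x\<in>V. \<Sum>z\<in>V. \<Sum>y\<in>V. of_real (f x * f z * g y) * unity_root p (dotp n \<xi> (z + z - x - y)))"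
    unfolding prod ..
  also have "\<dots> = (\<Sum>x\<in>V. \<Sum>\<xi>\<in>V. \<Sum>z\<in>V. \<Sum>y\<in>V. of_real (f x * f z * g y) * unity_root p (dotp n \<xi> (z + z - x - y)))"
    by (rule sum.swap)
  also have "\<dots> = (\<Sum>x\<in>V. \<Sum>z\<in>V. \<Sum>\<xi>\<in>V. \<Sum>y\<in>V. of_real (f x * f z * g y) * unity_root p (dotp n \<xi> (z + z - x - y)))"
    by (intro sum.cong refl sum.swap)
  also have "\<dots> = (\<Sum>x\<in>V. \<Sum>z\<in>V. \<Sum>y\<in>V. \<Sum>\<xi>\<in>V. of_real (f x * f z * g y) * unity_root p (dotp n \<xi> (z + z - x - y)))"
    by (intro sum.cong refl sum.swap)
  also have "\<dots> = (\<Sum>x\<in>V. \<Sum>z\<in>V. \<Sum>y\<in>V. if y = reduce_vec p n (z + z - x)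
      then of_real (f x * f z * g (z + z - x)) * of_nat (card V) else 0)"
  proof (intro sum.cong refl)
    fix x z y assume "x \<in> V" "z \<in> V" "y \<in> V"
    have "(\<forall>i<n. int p dvd (z + z - x - y) i) \<longleftrightarrow> y = reduce_vec p n (z + z - x)"
      using \<open>y \<in> V\<close> reduce_vec_mod_eq[of p n "z + z - x" y] unfolding V_def
      by (auto simp: reduce_vec_id mod_eq_dvd_iff)
    then show "(\<Sum>\<xi>\<in>V. of_real (f x * f z * g y) * unity_root p (dotp n \<xi> (z + z - x - y))) =
      (if y = reduce_vec p n (z + z - x)
      then of_real (f x * f z * g (z + z - x)) * of_nat (card V) else 0)"
      using unity_root_orthogonality[OF p, of n "z + z - x - y"]
      unfolding sum_distrib_left[symmetric] V_def by (simp add: periodic_reduce_vec[OF g])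
  qed
  also have "\<dots> = of_real (card V * (\<Sum>x\<in>V. \<Sum>z\<in>V. f x * f z * g (z + z - x)))"
    by (simp add: V_def reduce_vec_in_vecs[OF p] sum_distrib_left mult.commute)
  finally show ?thesis unfolding V_def .
qed

text \<open>Translation by \<open>h\<close> multiplies the transform by a root of unity. The
  resulting factor vanishes where \<open>p\<close> divides \<open>dotp n \<xi> h\<close> and has
  modulus at most 2 elsewhere.\<close>

lemma fourier_shift_diff:
  fixes g :: "(nat \<Rightarrow> int) \<Rightarrow> real"
  assumes p: "p > 0" and g: "periodic p n g"
  shows "fourier p n (\<lambda>y. g (y + h) - g y) \<xi> = (unity_root p (dotp n \<xi> h) - 1) * fourier p n g \<xi>"
proof -
  define \<phi> where "\<phi> y = of_real (g y) * unity_root p (- dotp n \<xi> y)" for y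
  have "periodic p n \<phi>"
    unfolding periodic_def
  proof (intro allI impI)
    fix x y assume xy: "\<forall>i<n. x i mod int p = y i mod int p"
    have "g x = g y" by (rule periodicD[OF g]) (use xy in auto)
    moreover have "unity_root p (dotp n \<xi> x) = unity_root p (dotp n \<xi> y)"
      by (rule periodicD[OF periodic_unity_root_dotp[OF p]]) (use xy in auto)
    ultimately show "\<phi> x = \<phi> y" by (simp add: \<phi>_def cnj_unity_root[symmetric])
  qed
  from sum_vecs_translate[OF p this, of h]
  have "(\<Sum>y\<in>vecs p n. unity_root p (dotp n \<xi> h) * \<phi> (y + h)) = unity_root p (dotp n \<xi> h) * fourier p n g \<xi>"
    by (simp add: sum_distrib_left[symmetric] fourier_def \<phi>_def)
  moreover have "unity_root p (dotp n \<xi> h) * \<phi> (y + h) = of_real (g (y + h)) * unity_root p (- dotp n \<xi> y)" for y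
  proof -
    have "unity_root p (dotp n \<xi> h) * unity_root p (- dotp n \<xi> (y + h)) = unity_root p (- dotp n \<xi> y)"
      by (simp add: unity_root_add[symmetric] dotp_add)
    then show ?thesis by (simp add: \<phi>_def mult.left_commute)
  qed
  ultimately show ?thesis by (simp add: fourier_def sum_subtractf algebra_simps)
qed

section \<open>Large spectrum and almost invariance\<close>

definition large_spectrum :: "nat \<Rightarrow> nat \<Rightarrow> real \<Rightarrow> ((nat \<Rightarrow> int) \<Rightarrow> real) \<Rightarrow> (nat \<Rightarrow> int) set" where
  "large_spectrum p n \<epsilon> f = {\<xi> \<in> vecs p n. cmod (fourier p n f \<xi>) > \<epsilon> * card (vecs p n)}"

lemma parseval_le:
  fixes f :: "(nat \<Rightarrow> int) \<Rightarrow> real"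
  assumes "p > 0" "coprime (int p) k" and f: "\<And>x. 0 \<le> f x" "\<And>x. f x \<le> 1"
  shows "(\<Sum>\<xi>\<in>vecs p n. (cmod (fourier p n f (\<lambda>i. k * \<xi> i)))\<^sup>2) \<le> (real (card (vecs p n)))\<^sup>2"
proof -
  have "(\<Sum>x\<in>vecs p n. (f x)\<^sup>2) \<le> (\<Sum>x\<in>vecs p n. 1)"
    by (intro sum_mono power_le_one f)
  then show ?thesis
    unfolding parseval_dilated[OF assms(1,2)] by (simp add: power2_eq_square mult_left_mono)
qed

text \<open>Chebyshev's inequality applied to Parseval. The bound does not involve \<open>n\<close>,
  so the codimension will be bounded uniformly.\<close>

lemma card_large_spectrum:
  fixes f :: "(nat \<Rightarrow> int) \<Rightarrow> real"
  assumes "p > 0" "\<epsilon> > 0" and f: "\<And>x. 0 \<le> f x" "\<And>x. f x \<le> 1"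
  shows "card (large_spectrum p n \<epsilon> f) \<le> 1 / \<epsilon>\<^sup>2"
proof -
  define N where "N = real (card (vecs p n))"
  have N: "N > 0" using card_vecs_pos[OF assms(1)] by (simp add: N_def)
  have "card (large_spectrum p n \<epsilon> f) * (\<epsilon> * N)\<^sup>2 = (\<Sum>\<xi>\<in>large_spectrum p n \<epsilon> f. (\<epsilon> * N)\<^sup>2)" by simp
  also have "\<dots> \<le> (\<Sum>\<xi>\<in>large_spectrum p n \<epsilon> f. (cmod (fourier p n f \<xi>))\<^sup>2)"
    using assms(2) N by (intro sum_mono power_mono) (auto simp: large_spectrum_def N_def)
  also have "\<dots> \<le> (\<Sum>\<xi>\<in>vecs p n. (cmod (fourier p n f \<xi>))\<^sup>2)"
    by (rule sum_mono2) (auto simp: large_spectrum_def)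
  also have "\<dots> \<le> N\<^sup>2" using parseval_le[OF assms(1) _ f, of 1 n] by (simp add: N_def)
  finally have "(card (large_spectrum p n \<epsilon> f) * \<epsilon>\<^sup>2) * N\<^sup>2 \<le> 1 * N\<^sup>2"
    by (simp add: power_mult_distrib mult.assoc)
  then have "card (large_spectrum p n \<epsilon> f) * \<epsilon>\<^sup>2 \<le> 1" by (rule mult_right_le_imp_le) (use N in simp)
  then show ?thesis using assms(2) by (simp add: pos_le_divide_eq)
qed

text \<open>The transform of \<open>g y = f (y + h) - f y\<close> vanishes on the large spectrum and
  is at most \<open>2 * \<epsilon> * N\<close> off it, where the transform of \<open>f\<close> is
  small. The other two factors are summed by \<open>a * b \<le> (a^2 + b^2) / 2\<close> and
  Parseval; \<open>p\<close> being odd makes -2 invertible.\<close>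

lemma three_term_almost_invariant:
  fixes f :: "(nat \<Rightarrow> int) \<Rightarrow> real"
  assumes p: "p > 0" "odd p" and f: "\<And>x. 0 \<le> f x" "\<And>x. f x \<le> 1" and per: "periodic p n f"
    and \<epsilon>: "\<epsilon> > 0" and h: "\<And>\<xi>. \<xi> \<in> large_spectrum p n \<epsilon> f \<Longrightarrow> int p dvd dotp n \<xi> h"
  shows "\<bar>\<Sum>x\<in>vecs p n. \<Sum>z\<in>vecs p n. f x * f z * (f (z + z - x + h) - f (z + z - x))\<bar>
     \<le> 2 * \<epsilon> * (real (card (vecs p n)))\<^sup>2"
proof -
  define V where "V = vecs p n"
  define N where "N = real (card V)"
  have N: "N > 0" using card_vecs_pos[OF p(1)] by (simp add: N_def V_def)
  define g where "g y = f (y + h) - f y" for y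
  define T where "T = (\<Sum>x\<in>V. \<Sum>z\<in>V. f x * f z * g (z + z - x))"
  have g: "periodic p n g"
    unfolding periodic_def g_def
  proof (intro allI impI)
    fix x y assume xy: "\<forall>i<n. x i mod int p = y i mod int p"
    have "f (x + h) = f (y + h)"
      by (rule periodicD[OF per], unfold plus_fun_apply, intro mod_add_cong) (use xy in auto)
    moreover have "f x = f y" by (rule periodicD[OF per]) (use xy in auto)
    ultimately show "f (x + h) - f x = f (y + h) - f y" by simp
  qed
  have small: "cmod (fourier p n g \<xi>) \<le> 2 * \<epsilon> * N" if "\<xi> \<in> V" for \<xi>
  proof (cases "\<xi> \<in> large_spectrum p n \<epsilon> f")
    case True
    then have "unity_root p (dotp n \<xi> h) = 1" using h unity_root_eq_1_iff[OF p(1)] by blast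
    then show ?thesis using \<epsilon> N unfolding g_def fourier_shift_diff[OF p(1) per] by simp
  next
    case False
    then have "cmod (fourier p n f \<xi>) \<le> \<epsilon> * N" using that by (simp add: large_spectrum_def V_def N_def)
    moreover have "cmod (unity_root p (dotp n \<xi> h) - 1) \<le> 2"
      using norm_triangle_ineq4[of "unity_root p (dotp n \<xi> h)" 1] by simp
    ultimately have "cmod (unity_root p (dotp n \<xi> h) - 1) * cmod (fourier p n f \<xi>) \<le> 2 * (\<epsilon> * N)"
      by (intro mult_mono) auto
    then show ?thesis unfolding g_def fourier_shift_diff[OF p(1) per] by (simp add: norm_mult)
  qed
  have cop: "coprime (int p) (-2)" using p(2) by (simp add: coprime_right_2_iff_odd)
  define a where "a \<xi> = cmod (fourier p n f \<xi>)" for \<xi>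
  define b where "b \<xi> = cmod (fourier p n f (\<lambda>i. -2 * \<xi> i))" for \<xi>
  have "N * \<bar>T\<bar> = cmod (of_real (card V * T))"
    using N by (simp add: N_def norm_mult)
  also have "\<dots> = cmod (\<Sum>\<xi>\<in>V. fourier p n f \<xi> * fourier p n f (\<lambda>i. -2 * \<xi> i) * fourier p n g \<xi>)"
    unfolding V_def T_def fourier_three_term[OF p(1) g] ..
  also have "\<dots> \<le> (\<Sum>\<xi>\<in>V. cmod (fourier p n f \<xi> * fourier p n f (\<lambda>i. -2 * \<xi> i) * fourier p n g \<xi>))"
    by (rule norm_sum)
  also have "\<dots> \<le> (\<Sum>\<xi>\<in>V. ((a \<xi>)\<^sup>2 + (b \<xi>)\<^sup>2) / 2 * (2 * \<epsilon> * N))"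
  proof (rule sum_mono)
    fix \<xi> assume "\<xi> \<in> V"
    have "a \<xi> * b \<xi> \<le> ((a \<xi>)\<^sup>2 + (b \<xi>)\<^sup>2) / 2"
      using sum_squares_bound[of "a \<xi>" "b \<xi>"] by simp
    then have "a \<xi> * b \<xi> * cmod (fourier p n g \<xi>) \<le> ((a \<xi>)\<^sup>2 + (b \<xi>)\<^sup>2) / 2 * (2 * \<epsilon> * N)"
      using small[OF \<open>\<xi> \<in> V\<close>] by (intro mult_mono) auto
    then show "cmod (fourier p n f \<xi> * fourier p n f (\<lambda>i. -2 * \<xi> i) * fourier p n g \<xi>)
       \<le> ((a \<xi>)\<^sup>2 + (b \<xi>)\<^sup>2) / 2 * (2 * \<epsilon> * N)"
      by (simp only: norm_mult a_def b_def)
  qed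
  also have "\<dots> = ((\<Sum>\<xi>\<in>V. (a \<xi>)\<^sup>2) + (\<Sum>\<xi>\<in>V. (b \<xi>)\<^sup>2)) / 2 * (2 * \<epsilon> * N)"
    by (simp only: sum.distrib sum_divide_distrib[symmetric] sum_distrib_right[symmetric])
  also have "\<dots> \<le> (N\<^sup>2 + N\<^sup>2) / 2 * (2 * \<epsilon> * N)"
  proof (intro mult_right_mono divide_right_mono add_mono)
    show "(\<Sum>\<xi>\<in>V. (a \<xi>)\<^sup>2) \<le> N\<^sup>2"
      using parseval_le[OF p(1) _ f, of 1 n] by (simp add: a_def V_def N_def)
    show "(\<Sum>\<xi>\<in>V. (b \<xi>)\<^sup>2) \<le> N\<^sup>2"
      using parseval_le[OF p(1) cop f, of n] by (simp only: b_def V_def N_def)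
  qed (use \<epsilon> N in auto)
  also have "\<dots> = N * (2 * \<epsilon> * N\<^sup>2)" by simp
  finally have "\<bar>T\<bar> \<le> 2 * \<epsilon> * N\<^sup>2" by (rule mult_left_le_imp_le) (rule N)
  then show ?thesis unfolding T_def V_def N_def g_def by (simp add: algebra_simps)
qed

section \<open>Monochromatic values of x + y - 2z\<close>

text \<open>If a shift \<open>h\<close> annihilated by all large spectra had no monochromatic
  solution, its count would be 0, while at shift 0 the count is the number of monochromatic
  progressions, at least \<open>N^2 / q\<close>. Almost invariance, summed over the colours, forbids
  this gap.\<close>

lemma mono_three_term_subspace:
  assumes "odd p"
  shows "\<exists>K. \<forall>n (c :: (nat \<Rightarrow> int) \<Rightarrow> nat). periodic p n c \<longrightarrow> range c \<subseteq> {..<r} \<longrightarrow>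
    (\<exists>\<Xi>\<subseteq>vecs p n. card \<Xi> \<le> K \<and> (\<forall>h. (\<forall>\<xi>\<in>\<Xi>. int p dvd dotp n \<xi> h) \<longrightarrow>
      (\<exists>x\<in>vecs p n. \<exists>z\<in>vecs p n. c x = c z \<and> c (z + z - x + h) = c z)))"
proof -
  have p: "p > 0" using assms by (rule odd_pos)
  obtain q where q: "q > 0" and Q: "\<And>p n (c :: (nat \<Rightarrow> int) \<Rightarrow> nat). p > 0 \<Longrightarrow> periodic p n c \<Longrightarrow> range c \<subseteq> {..<r} \<Longrightarrow>
     (real (card (vecs p n)))\<^sup>2 \<le> real q * (\<Sum>x\<in>vecs p n. \<Sum>d\<in>vecs p n. ap_indicator c x d)"
    using ap_count_lower_bound[of r] by blast
  \<comment> \<open>With this value \<open>q * (r * (2 * \<epsilon> * N^2))\<close> equals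
    \<open>r / (2 * (r + 1))\<close> times \<open>N^2\<close>, which is below
    \<open>N^2\<close>.\<close>
  define \<epsilon> where "\<epsilon> = 1 / (4 * real q * (real r + 1))"
  have \<epsilon>: "\<epsilon> > 0" using q by (simp add: \<epsilon>_def)
  have "\<exists>\<Xi>\<subseteq>vecs p n. card \<Xi> \<le> nat \<lfloor>r / \<epsilon>\<^sup>2\<rfloor> \<and> (\<forall>h. (\<forall>\<xi>\<in>\<Xi>. int p dvd dotp n \<xi> h) \<longrightarrow>
      (\<exists>x\<in>vecs p n. \<exists>z\<in>vecs p n. c x = c z \<and> c (z + z - x + h) = c z))"
    if c: "periodic p n c" "range c \<subseteq> {..<r}" for n and c :: "(nat \<Rightarrow> int) \<Rightarrow> nat"
  proof -
    define V where "V = vecs p n"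
    define N where "N = real (card V)"
    have N: "N > 0" using card_vecs_pos[OF p] by (simp add: N_def V_def)
    define f where "f i x = (of_bool (c x = i) :: real)" for i x
    have f: "0 \<le> f i x" "f i x \<le> 1" "periodic p n (f i)" for i x
      using c(1) by (auto simp: f_def periodic_def)
    define \<Xi> where "\<Xi> = (\<Union>i<r. large_spectrum p n \<epsilon> (f i))"
    have "real (card \<Xi>) \<le> real (\<Sum>i<r. card (large_spectrum p n \<epsilon> (f i)))"
      unfolding \<Xi>_def of_nat_le_iff by (rule card_UN_le) simp
    also have "\<dots> \<le> (\<Sum>i<r. 1 / \<epsilon>\<^sup>2)"
      unfolding of_nat_sum by (intro sum_mono card_large_spectrum p \<epsilon> f)
    finally have card: "card \<Xi> \<le> nat \<lfloor>r / \<epsilon>\<^sup>2\<rfloor>" by (simp add: le_nat_floor)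
    have "\<exists>x\<in>V. \<exists>z\<in>V. c x = c z \<and> c (z + z - x + h) = c z"
      if h: "\<And>\<xi>. \<xi> \<in> \<Xi> \<Longrightarrow> int p dvd dotp n \<xi> h" for h
    proof (rule ccontr)
      assume none: "\<not> ?thesis"
      \<comment> \<open>Only the summand for the colour of \<open>z\<close> can be nonzero.\<close>
      have split: "(\<Sum>i<r. f i x * f i z * f i y) = of_bool (c x = c z \<and> c y = c z)" for x y z
      proof -
        have "(\<Sum>i<r. f i x * f i z * f i y) = (\<Sum>i<r. if i = c z then of_bool (c x = c z \<and> c y = c z) else 0)"
          by (rule sum.cong) (auto simp: f_def)
        also have "\<dots> = of_bool (c x = c z \<and> c y = c z)" using c(2) by auto
        finally show ?thesis .
      qed
      have swap: "(\<Sum>i<r. \<Sum>x\<in>V. \<Sum>z\<in>V. F i x z) = (\<Sum>x\<in>V. \<Sum>z\<in>V. \<Sum>i<r. F i x z)"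
        for F :: "nat \<Rightarrow> (nat \<Rightarrow> int) \<Rightarrow> (nat \<Rightarrow> int) \<Rightarrow> real"
        by (subst sum.swap, intro sum.cong refl, rule sum.swap)
      have Th: "(\<Sum>i<r. \<Sum>x\<in>V. \<Sum>z\<in>V. f i x * f i z * f i (z + z - x + h)) = 0"
        unfolding swap split using none by (auto intro!: sum.neutral)
      have T0: "(\<Sum>i<r. \<Sum>x\<in>V. \<Sum>z\<in>V. f i x * f i z * f i (z + z - x)) = (\<Sum>x\<in>V. \<Sum>d\<in>V. ap_indicator c x d)"
        unfolding swap split
      proof (rule sum.cong[OF refl])
        fix x
        define \<phi> where "\<phi> z = (of_bool (c x = c z \<and> c (z + z - x) = c z) :: real)" for z
        have "periodic p n \<phi>"
          unfolding periodic_def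
        proof (intro allI impI)
          fix y z assume yz: "\<forall>i<n. y i mod int p = z i mod int p"
          have "c y = c z" by (rule periodicD[OF c(1)]) (use yz in auto)
          moreover have "c (y + y - x) = c (z + z - x)"
            by (rule periodicD[OF c(1)], unfold plus_fun_apply minus_apply, intro mod_add_cong mod_diff_cong)
              (use yz in auto)
          ultimately show "\<phi> y = \<phi> z" by (simp add: \<phi>_def)
        qed
        \<comment> \<open>Substituting \<open>z = d + x\<close> turns \<open>z + z - x\<close> into
          \<open>x + d + d\<close>.\<close>
        from sum_vecs_translate[OF p this, of x]
        have "(\<Sum>z\<in>V. \<phi> z) = (\<Sum>d\<in>V. \<phi> (d + x))" by (simp add: V_def)
        also have "\<dots> = (\<Sum>d\<in>V. ap_indicator c x d)"
        proof (rule sum.cong[OF refl])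
          fix d
          have eq: "x + d + (x + d) - x = x + d + d" "d + x = x + d" by (simp_all add: algebra_simps)
          show "\<phi> (d + x) = ap_indicator c x d"
            unfolding \<phi>_def ap_indicator_def eq by (rule arg_cong[where f = of_bool]) auto
        qed
        finally show "(\<Sum>z\<in>V. of_bool (c x = c z \<and> c (z + z - x) = c z)) = (\<Sum>d\<in>V. ap_indicator c x d)"
          by (simp add: \<phi>_def)
      qed
      define T where "T = (\<Sum>x\<in>V. \<Sum>d\<in>V. ap_indicator c x d)"
      define \<Delta> where "\<Delta> i = (\<Sum>x\<in>V. \<Sum>z\<in>V. f i x * f i z * (f i (z + z - x + h) - f i (z + z - x)))" for i
      have "\<bar>\<Delta> i\<bar> \<le> 2 * \<epsilon> * N\<^sup>2" if "i < r" for i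
        unfolding \<Delta>_def V_def N_def
      proof (rule three_term_almost_invariant[OF p assms f \<epsilon>])
        fix \<xi> assume "\<xi> \<in> large_spectrum p n \<epsilon> (f i)"
        then show "int p dvd dotp n \<xi> h" using that by (intro h) (auto simp: \<Xi>_def)
      qed
      then have "(\<Sum>i<r. \<bar>\<Delta> i\<bar>) \<le> (\<Sum>i<r. 2 * \<epsilon> * N\<^sup>2)" by (intro sum_mono) simp
      then have "\<bar>\<Sum>i<r. \<Delta> i\<bar> \<le> (\<Sum>i<r. 2 * \<epsilon> * N\<^sup>2)" by (rule order_trans[OF sum_abs])
      moreover have "(\<Sum>i<r. \<Delta> i) = - T"
        unfolding \<Delta>_def right_diff_distrib sum_subtractf Th T0 T_def by (rule diff_0)
      ultimately have "T \<le> r * (2 * \<epsilon> * N\<^sup>2)" by simp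
      moreover have "N\<^sup>2 \<le> q * T" using Q[OF p c] by (simp add: N_def T_def V_def)
      ultimately have "N\<^sup>2 \<le> q * (r * (2 * \<epsilon> * N\<^sup>2))"
        by (meson mult_left_mono of_nat_0_le_iff order_trans)
      also have "\<dots> = (real r / (2 * (real r + 1))) * N\<^sup>2"
      proof -
        have q\<epsilon>: "q * \<epsilon> = 1 / (4 * (real r + 1))" using q by (simp add: \<epsilon>_def)
        have "q * (r * (2 * \<epsilon> * N\<^sup>2)) = (q * \<epsilon>) * (2 * real r * N\<^sup>2)"
          by (simp only: mult_ac)
        moreover have "1 / (4 * R) * (2 * a * b) = a / (2 * R) * b" for R a b :: real by simp
        ultimately show ?thesis unfolding q\<epsilon> by (rule trans)
      qed
      also have "\<dots> < 1 * N\<^sup>2"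
        by (rule mult_strict_right_mono) (use N in auto)
      finally show False by simp
    qed
    moreover have "\<Xi> \<subseteq> vecs p n" by (auto simp: \<Xi>_def large_spectrum_def)
    ultimately show ?thesis using card unfolding V_def by (intro exI[of _ \<Xi>] conjI allI impI) simp_all
  qed
  then show ?thesis by blast
qed

section \<open>Passage to infinite dimension by compactness\<close>

text \<open>Sequential compactness over a finite alphabet. Stage \<open>i\<close> thins the indices
  by pigeonhole until coordinate \<open>i\<close> is constant; the diagonal subsequence has
  coordinate \<open>i\<close> constant from index \<open>Suc i\<close> on, so at index
  \<open>m\<close> its first \<open>m\<close> coordinates have reached their limits.\<close>

lemma pointwise_cluster_point:
  fixes X :: "nat \<Rightarrow> nat \<Rightarrow> 'a"
  assumes "finite T" "\<And>n i. X n i \<in> T"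
  shows "\<exists>Y. \<forall>m. \<exists>n\<ge>m. \<forall>i<m. X n i = Y i"
proof -
  define P where "P i s \<longleftrightarrow> (\<exists>v. \<forall>k. X (s k) i = v)" for i and s :: "nat \<Rightarrow> nat"
  interpret subseqs P
  proof
    fix i and s :: "nat \<Rightarrow> nat" assume "strict_mono s"
    have "finite (range (\<lambda>k. X (s k) i))"
      by (rule finite_subset[OF _ assms(1)]) (use assms(2) in auto)
    then obtain k0 where "infinite {k. X (s k) i = X (s k0) i}"
      using pigeonhole_infinite[of UNIV "\<lambda>k. X (s k) i"] by auto
    from infinite_enumerate[OF this] show "\<exists>r'. strict_mono r' \<and> P i (s \<circ> r')"
      unfolding P_def by auto
  qed
  have "P i (diagseq \<circ> ((+) (Suc i)))" for i
    by (rule diagseq_holds) (auto simp: P_def)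
  then obtain Y where Y: "\<And>i k. X (diagseq (Suc i + k)) i = Y i"
    unfolding P_def by (metis comp_apply)
  have "X (diagseq m) i = Y i" if "i < m" for i m
    using Y[of i "m - Suc i"] that by simp
  moreover have "diagseq m \<ge> m" for m using subseq_diagseq by (rule seq_suble)
  ultimately show ?thesis by blast
qed

lemma vecs_mono: "m \<le> n \<Longrightarrow> p > 0 \<Longrightarrow> vecs p m \<subseteq> vecs p n"
proof
  fix x assume "m \<le> n" "p > 0" and x: "x \<in> vecs p m"
  have "x i \<in> {0..<int p}" for i
    using x \<open>p > 0\<close> unfolding vecs_def by (cases "i < m") auto
  moreover have "x i = 0" if "i \<ge> n" for i
    using x \<open>m \<le> n\<close> that unfolding vecs_def by auto
  ultimately show "x \<in> vecs p n" by (auto simp: vecs_def)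
qed

lemma dotp_extend:
  assumes "h \<in> vecs p m" "m \<le> n" shows "dotp n \<xi> h = dotp m \<xi> h"
  unfolding dotp_def
  by (rule sum.mono_neutral_right) (use assms in \<open>auto simp: vecs_def\<close>)

text \<open>Each dimension \<open>n\<close> supplies \<open>K\<close> vectors, and a cluster point
  of them defines \<open>K\<close> characters of the infinite sum. A given \<open>h\<close> in
  \<open>vecs p m\<close> sees only the first \<open>m\<close> coordinates, on which some level
  \<open>n \<ge> m\<close> agrees with the limit; the solution found at that level serves.\<close>

lemma mono_three_term_characters:
  fixes c :: "(nat \<Rightarrow> int) \<Rightarrow> nat"
  assumes "odd p" and c: "range c \<subseteq> {..<r}"
  shows "\<exists>(K::nat) \<xi>. \<forall>m h. h \<in> vecs p m \<longrightarrow> (\<forall>j<K. int p dvd dotp m (\<xi> j) h) \<longrightarrow>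
    (\<exists>n\<ge>m. \<exists>x\<in>vecs p n. \<exists>z\<in>vecs p n. c x = c z \<and> c (reduce_vec p n (z + z - x + h)) = c z)"
proof -
  have p: "p > 0" using assms by (auto intro: odd_pos)
  \<comment> \<open>The colouring seen on the first \<open>n\<close> coordinates, made
    periodic.\<close>
  define cn where "cn n x = c (reduce_vec p n x)" for n x
  have cn: "periodic p n (cn n)" "range (cn n) \<subseteq> {..<r}" for n
  proof -
    show "periodic p n (cn n)"
      unfolding periodic_def cn_def by (simp add: reduce_vec_mod_eq[symmetric])
    show "range (cn n) \<subseteq> {..<r}" using c by (auto simp: cn_def)
  qed
  define good where "good n h \<longleftrightarrow>
      (\<exists>x\<in>vecs p n. \<exists>z\<in>vecs p n. cn n x = cn n z \<and> cn n (z + z - x + h) = cn n z)" for n h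
  obtain K where K: "\<forall>n (c :: (nat \<Rightarrow> int) \<Rightarrow> nat). periodic p n c \<longrightarrow> range c \<subseteq> {..<r} \<longrightarrow>
    (\<exists>\<Xi>\<subseteq>vecs p n. card \<Xi> \<le> K \<and> (\<forall>h. (\<forall>\<xi>\<in>\<Xi>. int p dvd dotp n \<xi> h) \<longrightarrow>
      (\<exists>x\<in>vecs p n. \<exists>z\<in>vecs p n. c x = c z \<and> c (z + z - x + h) = c z)))"
    using mono_three_term_subspace[OF assms(1), of r] ..
  have "\<exists>e. (\<forall>j. e j \<in> vecs p n) \<and> (\<forall>h. (\<forall>j<K. int p dvd dotp n (e j) h) \<longrightarrow> good n h)" for n
  proof -
    obtain \<Xi> where \<Xi>: "\<Xi> \<subseteq> vecs p n" "card \<Xi> \<le> K"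
      "\<And>h. (\<forall>\<xi>\<in>\<Xi>. int p dvd dotp n \<xi> h) \<Longrightarrow> good n h"
      using K[rule_format, OF cn(1,2)[of n]] unfolding good_def[symmetric] by blast
    have "finite \<Xi>" using \<Xi>(1) by (rule finite_subset) simp
    then obtain b where b: "bij_betw b {0..<card \<Xi>} \<Xi>" using ex_bij_betw_nat_finite by blast
    \<comment> \<open>Padding with the zero vector, whose divisibility condition always holds, gives
      every level a list of length \<open>K\<close>.\<close>
    define e where "e j = (if j < card \<Xi> then b j else 0)" for j
    have "e j \<in> vecs p n" for j
      using b \<Xi>(1) zero_in_vecs[OF p] by (auto simp: e_def bij_betw_def)
    moreover have "\<Xi> \<subseteq> e ` {..<K}"
    proof
      fix \<xi> assume "\<xi> \<in> \<Xi>"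
      then have "\<xi> \<in> b ` {0..<card \<Xi>}" using b by (simp add: bij_betw_def)
      then obtain j where "j < card \<Xi>" "b j = \<xi>" by auto
      then have "\<xi> = e j" "j \<in> {..<K}" using \<Xi>(2) by (auto simp: e_def)
      then show "\<xi> \<in> e ` {..<K}" by (rule image_eqI)
    qed
    ultimately show ?thesis using \<Xi>(3) by (intro exI[of _ e]) blast
  qed
  then have "\<exists>e. \<forall>n. (\<forall>j. e n j \<in> vecs p n) \<and> (\<forall>h. (\<forall>j<K. int p dvd dotp n (e n j) h) \<longrightarrow> good n h)"
    by (intro choice allI)
  then obtain e where e: "\<And>n j. e n j \<in> vecs p n"
    and eh: "\<And>n h. (\<And>j. j < K \<Longrightarrow> int p dvd dotp n (e n j) h) \<Longrightarrow> good n h"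
    by blast
  \<comment> \<open>The \<open>K\<close> vectors are packed into one sequence over a finite set, so
    that a single cluster point handles them together.\<close>
  define X where "X n i = (\<lambda>j\<in>{..<K}. e n j i)" for n i
  have "\<exists>Y. \<forall>m. \<exists>n\<ge>m. \<forall>i<m. X n i = Y i"
  proof (rule pointwise_cluster_point)
    show "finite (PiE {..<K} (\<lambda>_. {0..<int p}))" by (intro finite_PiE) auto
    show "X n i \<in> PiE {..<K} (\<lambda>_. {0..<int p})" for n i
    proof -
      have "e n j i \<in> {0..<int p}" for j using e[of n j] p by (cases "i < n") (auto simp: vecs_def)
      then show ?thesis unfolding X_def by (simp only: restrict_PiE_iff) blast
    qed
  qed
  then obtain Y where Y: "\<And>m. \<exists>n\<ge>m. \<forall>i<m. X n i = Y i" by blast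
  define \<xi> where "\<xi> j i = Y i j" for j i
  have sol: "\<exists>n\<ge>m. \<exists>x\<in>vecs p n. \<exists>z\<in>vecs p n. c x = c z \<and> c (reduce_vec p n (z + z - x + h)) = c z"
    if h: "h \<in> vecs p m" "\<And>j. j < K \<Longrightarrow> int p dvd dotp m (\<xi> j) h" for m h
  proof -
    obtain n where n: "n \<ge> m" "\<And>i. i < m \<Longrightarrow> X n i = Y i" using Y by blast
    have "int p dvd dotp n (e n j) h" if "j < K" for j
    proof -
      have "dotp m (e n j) h = dotp m (\<xi> j) h"
        unfolding dotp_def
      proof (intro sum.cong refl)
        fix i assume "i \<in> {..<m}"
        then have "X n i j = Y i j" using n(2) by simp
        then show "e n j i * h i = \<xi> j i * h i" using that by (simp add: X_def \<xi>_def)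
      qed
      then show ?thesis using h(2)[OF that] dotp_extend[OF h(1) n(1)] by simp
    qed
    from eh[of n h, OF this] show ?thesis
      using n(1) by (auto simp: good_def cn_def reduce_vec_id)
  qed
  show ?thesis
  proof (rule exI[of _ K], rule exI[of _ \<xi>], intro allI impI)
    fix m h
    assume "h \<in> vecs p m" "\<forall>j<K. int p dvd dotp m (\<xi> j) h"
    then show "\<exists>n\<ge>m. \<exists>x\<in>vecs p n. \<exists>z\<in>vecs p n. c x = c z \<and> c (reduce_vec p n (z + z - x + h)) = c z"
      by (intro sol) simp_all
  qed
qed

section \<open>The direct sum, the torus and Bohr recurrence\<close>

lemma mult_Fp_omega: "x \<otimes>\<^bsub>Fp_omega p\<^esub> y = (\<lambda>i. (x i + y i) mod int p)"
  by (simp add: Fp_omega_def fun_eq_iff)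

lemma one_Fp_omega: "\<one>\<^bsub>Fp_omega p\<^esub> = (\<lambda>_. 0)"
  by (simp add: Fp_omega_def fun_eq_iff)

lemma group_Fp_omega: "group (Fp_omega p)"
  by (rule comm_group.axioms(2)[OF comm_group_Fp_omega])

lemma vecs_subset_Fp_omega: "p > 0 \<Longrightarrow> vecs p n \<subseteq> carrier (Fp_omega p)"
proof
  fix x assume "p > 0" and x: "x \<in> vecs p n"
  have "0 \<le> x i \<and> x i < int p" for i
    using x \<open>p > 0\<close> unfolding vecs_def by (cases "i < n") auto
  moreover have "{i. x i \<noteq> 0} \<subseteq> {..<n}" using x unfolding vecs_def by auto
  ultimately show "x \<in> carrier (Fp_omega p)"
    using \<open>p > 0\<close> finite_subset by (auto simp: carrier_Fp_omega)
qed

lemma Fp_omega_in_vecs: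
  assumes "p > 0" "x \<in> carrier (Fp_omega p)"
  obtains n where "x \<in> vecs p n"
proof -
  have x: "\<And>i. 0 \<le> x i \<and> x i < int p" "finite {i. x i \<noteq> 0}" using assms by (auto simp: carrier_Fp_omega)
  then obtain n where "\<forall>i\<in>{i. x i \<noteq> 0}. i < n" using finite_nat_set_iff_bounded by blast
  then have "x \<in> vecs p n" using x(1) by (auto simp: vecs_def)
  then show ?thesis by (rule that)
qed

lemma group_diff_Fp_omega:
  assumes p: "p > 0" and ab: "a \<in> carrier (Fp_omega p)" "b \<in> carrier (Fp_omega p)"
  shows "group_diff (Fp_omega p) b a = (\<lambda>i. (b i - a i) mod int p)"
proof -
  interpret group "Fp_omega p" by (rule group_Fp_omega)
  define d where "d i = (b i - a i) mod int p" for i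
  have "{i. d i \<noteq> 0} \<subseteq> {i. a i \<noteq> 0} \<union> {i. b i \<noteq> 0}" by (auto simp: d_def)
  moreover have "finite ({i. a i \<noteq> 0} \<union> {i. b i \<noteq> 0})" using ab p by (simp add: carrier_Fp_omega)
  ultimately have "finite {i. d i \<noteq> 0}" by (rule finite_subset)
  then have d: "d \<in> carrier (Fp_omega p)" using p by (simp add: carrier_Fp_omega d_def)
  have "b = d \<otimes>\<^bsub>Fp_omega p\<^esub> a"
    using ab p by (auto simp: mult_Fp_omega d_def carrier_Fp_omega mod_simps)
  then have "d = b \<otimes>\<^bsub>Fp_omega p\<^esub> inv\<^bsub>Fp_omega p\<^esub> a" using ab d inv_solve_right by blast
  then show ?thesis by (simp add: group_diff_def d_def fun_eq_iff)
qed

section \<open>The circle and the torus as groups\<close>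

lemma comm_group_real_add_group: "comm_group real_add_group"
proof (rule comm_groupI)
  fix x assume "x \<in> carrier real_add_group"
  have "(- x) \<otimes>\<^bsub>real_add_group\<^esub> x = \<one>\<^bsub>real_add_group\<^esub>" "- x \<in> carrier real_add_group"
    by (simp_all add: real_add_group_def)
  then show "\<exists>y\<in>carrier real_add_group. y \<otimes>\<^bsub>real_add_group\<^esub> x = \<one>\<^bsub>real_add_group\<^esub>" by blast
qed (auto simp: real_add_group_def)

lemma inv_real_add_group: "inv\<^bsub>real_add_group\<^esub> x = - x"
proof -
  interpret comm_group real_add_group by (rule comm_group_real_add_group)
  show ?thesis by (rule inv_equality) (simp_all add: real_add_group_def)
qed

lemma subgroup_Ints: "subgroup \<int> real_add_group"
proof
  fix x :: real assume "x \<in> \<int>"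
  then show "inv\<^bsub>real_add_group\<^esub> x \<in> \<int>" by (simp add: inv_real_add_group)
qed (auto simp: real_add_group_def)

lemma normal_Ints: "\<int> \<lhd> real_add_group"
  by (rule comm_group.subgroup_imp_normal[OF comm_group_real_add_group subgroup_Ints])

definition circle_pt :: "real \<Rightarrow> real set" where
  "circle_pt x = \<int> #>\<^bsub>real_add_group\<^esub> x"

lemma circle_pt_eq_iff: "circle_pt x = circle_pt y \<longleftrightarrow> x - y \<in> \<int>"
proof
  assume "circle_pt x = circle_pt y"
  moreover have "x \<in> circle_pt x" unfolding circle_pt_def coset_Ints by (rule image_eqI[of _ _ 0]) auto
  ultimately obtain n where "x = y - of_int n" unfolding circle_pt_def coset_Ints by auto
  then show "x - y \<in> \<int>" by simp
next
  assume xy: "x - y \<in> \<int>"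
  have sub: "circle_pt a \<subseteq> circle_pt b" if "a - b \<in> \<int>" for a b
  proof -
    from that obtain m where m: "a - b = of_int m" by (rule Ints_cases)
    have "a - of_int n = b - of_int (n - m)" for n using m by simp
    then show ?thesis unfolding circle_pt_def coset_Ints by blast
  qed
  have "y - x \<in> \<int>" using Ints_minus[OF xy] by simp
  then show "circle_pt x = circle_pt y" using sub[OF xy] sub by blast
qed

lemma circle_pt_mult: "circle_pt x \<otimes>\<^bsub>circle_group\<^esub> circle_pt y = circle_pt (x + y)"
  using normal.rcos_sum[OF normal_Ints, of x y]
  by (simp add: circle_pt_def circle_group_def real_add_group_def)

lemma one_circle_group: "\<one>\<^bsub>circle_group\<^esub> = circle_pt 0"
proof -
  interpret comm_group real_add_group by (rule comm_group_real_add_group)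
  have "\<int> #>\<^bsub>real_add_group\<^esub> \<one>\<^bsub>real_add_group\<^esub> = \<int>"
    by (rule coset_mult_one) (simp add: real_add_group_def)
  then show ?thesis by (simp add: circle_group_def circle_pt_def real_add_group_def)
qed

lemma carrier_circle_group: "carrier circle_group = range circle_pt"
  by (simp add: circle_group_def carrier_FactGroup circle_pt_def real_add_group_def)

lemma comm_group_circle_group: "comm_group circle_group"
  unfolding circle_group_def
  by (rule comm_group.abelian_FactGroup[OF comm_group_real_add_group subgroup_Ints])

lemma circle_norm_pt: "circle_norm (circle_pt x) = \<bar>x - of_int (round x)\<bar>"
  unfolding circle_pt_def by (rule circle_norm_coset_attained)

lemma carrier_torus_group: "carrier (torus_group d) = PiE {..<d} (\<lambda>_. range circle_pt)"
  by (simp add: torus_group_def carrier_circle_group)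

lemma comm_group_torus_group: "comm_group (torus_group d)"
proof -
  interpret C: comm_group circle_group by (rule comm_group_circle_group)
  interpret group "torus_group d" unfolding torus_group_def by simp
  show ?thesis
    by unfold_locales (auto simp: torus_group_def C.m_comm PiE_iff intro!: restrict_ext)
qed

lemma torus_norm_one: "torus_norm d \<one>\<^bsub>torus_group d\<^esub> = 0"
proof -
  have "(\<lambda>j. circle_norm (\<one>\<^bsub>torus_group d\<^esub> j)) ` {..<d} \<subseteq> {0}"
    by (auto simp: torus_group_def one_circle_group circle_norm_pt)
  then have "insert 0 ((\<lambda>j. circle_norm (\<one>\<^bsub>torus_group d\<^esub> j)) ` {..<d}) = {0}" by blast
  then show ?thesis unfolding torus_norm_def by (simp only: Max_singleton)
qed

lemma pow_torus_group: "u [^]\<^bsub>torus_group d\<^esub> (k::nat) = (\<lambda>j\<in>{..<d}. u j [^]\<^bsub>circle_group\<^esub> k)"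
  by (induction k) (auto simp: torus_group_def fun_eq_iff)

lemma pow_circle_pt: "circle_pt x [^]\<^bsub>circle_group\<^esub> (k::nat) = circle_pt (of_nat k * x)"
  by (induction k) (simp_all add: one_circle_group circle_pt_mult algebra_simps)

text \<open>Every coordinate of a point killed by \<open>p\<close> is one of the \<open>p\<close>
  classes of \<open>k / p\<close>. This makes the colouring of vertices by the images of basis
  vectors finite.\<close>

lemma finite_torus_torsion:
  fixes p :: nat
  assumes "p > 0"
  shows "finite {u \<in> carrier (torus_group d). u [^]\<^bsub>torus_group d\<^esub> p = \<one>\<^bsub>torus_group d\<^esub>}"
proof (rule finite_subset)
  define R where "R = (\<lambda>k. circle_pt (of_int k / of_nat p)) ` {0..<int p}"
  show "finite (PiE {..<d} (\<lambda>_. R))" unfolding R_def by (intro finite_PiE) auto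
  show "{u \<in> carrier (torus_group d). u [^]\<^bsub>torus_group d\<^esub> p = \<one>\<^bsub>torus_group d\<^esub>} \<subseteq> PiE {..<d} (\<lambda>_. R)"
  proof
    fix u assume "u \<in> {u \<in> carrier (torus_group d). u [^]\<^bsub>torus_group d\<^esub> p = \<one>\<^bsub>torus_group d\<^esub>}"
    then have u: "u \<in> PiE {..<d} (\<lambda>_. range circle_pt)" "u [^]\<^bsub>torus_group d\<^esub> p = \<one>\<^bsub>torus_group d\<^esub>"
      by (auto simp: carrier_torus_group)
    have "u j \<in> R" if j: "j < d" for j
    proof -
      obtain x where x: "u j = circle_pt x" using u(1) j by auto
      have "u j [^]\<^bsub>circle_group\<^esub> p = \<one>\<^bsub>circle_group\<^esub>"
        using fun_cong[OF u(2), of j] j unfolding pow_torus_group by (simp add: torus_group_def)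
      then have "of_nat p * x \<in> \<int>" by (simp add: x pow_circle_pt one_circle_group circle_pt_eq_iff)
      then obtain k :: int where k: "of_nat p * x = of_int k" by (auto simp: Ints_def)
      have "real_of_int k = of_int (k mod int p) + of_nat p * of_int (k div int p)"
        by (metis mod_mult_div_eq of_int_add of_int_mult of_int_of_nat_eq)
      then have "x - of_int (k mod int p) / of_nat p = of_int (k div int p)"
        using k assms by (simp add: field_simps)
      then have "circle_pt x = circle_pt (of_int (k mod int p) / of_nat p)"
        by (simp add: circle_pt_eq_iff)
      then show ?thesis using assms unfolding x R_def by (intro image_eqI[of _ _ "k mod int p"]) auto
    qed
    then show "u \<in> PiE {..<d} (\<lambda>_. R)" using u(1) by (auto simp: PiE_iff)
  qed
qed

section \<open>Bohr recurrence and characters of the direct sum\<close>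

lemma pow_Fp_omega:
  "x \<in> carrier (Fp_omega p) \<Longrightarrow> x [^]\<^bsub>Fp_omega p\<^esub> (k::nat) = (\<lambda>i. (int k * x i) mod int p)"
  by (induction k) (auto simp: one_Fp_omega mult_Fp_omega mod_simps algebra_simps)

lemma hom_basis_sum:
  assumes "comm_group H" "p > 1" "\<rho> \<in> hom (Fp_omega p) H" "finite F"
  shows "\<rho> (basis_sum p F) = finprod H (\<lambda>n. \<rho> (basis_vec n)) F"
proof -
  interpret H: comm_group H by (rule assms(1))
  interpret G: comm_group "Fp_omega p" by (rule comm_group_Fp_omega)
  have in_G: "basis_vec n \<in> carrier (Fp_omega p)" for n by (rule basis_vec_in_Fp_omega[OF assms(2)])
  have in_H: "\<rho> x \<in> carrier H" if "x \<in> carrier (Fp_omega p)" for x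
    using assms(3) that by (auto simp: hom_def)
  have one: "\<rho> \<one>\<^bsub>Fp_omega p\<^esub> = \<one>\<^bsub>H\<^esub>"
    by (rule hom_one[OF assms(3) G.is_group H.is_group])
  show ?thesis using assms(4)
  proof (induction F)
    case empty
    then show ?case by (simp add: basis_sum_def one)
  next
    case (insert n F)
    have "basis_sum p F \<in> carrier (Fp_omega p)"
      unfolding basis_sum_def by (rule G.finprod_closed) (use in_G in auto)
    moreover have "basis_sum p (insert n F) = basis_vec n \<otimes>\<^bsub>Fp_omega p\<^esub> basis_sum p F"
      using insert.hyps in_G by (simp add: basis_sum_def)
    ultimately show ?case using insert in_G in_H assms(3) by (simp add: hom_def)
  qed
qed

lemma bohr_recurrent_edge_vectors:
  assumes p: "p > 1" and unif: "uniform_hypergraph p (UNIV, \<F>)"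
    and chi: "hypergraph_chromatic_number (UNIV, \<F>) = \<infinity>"
  shows "bohr_recurrent (Fp_omega p) (edge_vectors p \<F>)"
  unfolding bohr_recurrent_def
proof (intro allI ballI impI)
  fix d \<rho> and \<epsilon> :: real
  assume \<rho>: "\<rho> \<in> hom (Fp_omega p) (torus_group d)" and \<epsilon>: "\<epsilon> > 0"
  interpret T: comm_group "torus_group d" by (rule comm_group_torus_group)
  interpret G: comm_group "Fp_omega p" by (rule comm_group_Fp_omega)
  define t where "t n = \<rho> (basis_vec n)" for n
  have tT: "t n \<in> carrier (torus_group d)" for n
    using \<rho> basis_vec_in_Fp_omega[OF p] by (auto simp: t_def hom_def)
  have tp: "t n [^]\<^bsub>torus_group d\<^esub> p = \<one>\<^bsub>torus_group d\<^esub>" for n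
  proof -
    have "t n [^]\<^bsub>torus_group d\<^esub> p = \<rho> (basis_vec n [^]\<^bsub>Fp_omega p\<^esub> p)"
      unfolding t_def
      using hom_nat_pow[OF \<rho> basis_vec_in_Fp_omega[OF p] G.is_group T.is_group] by simp
    also have "basis_vec n [^]\<^bsub>Fp_omega p\<^esub> p = \<one>\<^bsub>Fp_omega p\<^esub>"
      by (simp add: pow_Fp_omega basis_vec_in_Fp_omega[OF p] one_Fp_omega)
    finally show ?thesis using hom_one[OF \<rho> G.is_group T.is_group] by simp
  qed
  have fin: "finite (range t)"
    by (rule finite_subset[OF _ finite_torus_torsion[of p d]]) (use tT tp p in auto)
  \<comment> \<open>The fibres of \<open>t\<close>; indexing them by \<open>range t\<close> keeps
    each one nonempty, as a partition requires.\<close>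
  define P where "P = (\<lambda>u. t -` {u}) ` range t"
  have "partition_on UNIV P" unfolding partition_on_def P_def disjoint_def by auto
  moreover have "finite P" unfolding P_def using fin by simp
  moreover have "\<not> partition_colourable (UNIV, \<F>) (card P)"
    using chi unfolding hypergraph_chromatic_number_def by (auto split: if_splits)
  ultimately obtain F C where F: "F \<in> \<F>" "C \<in> P" "F \<subseteq> C"
    unfolding partition_colourable_def by auto
  then obtain u where u: "\<And>n. n \<in> F \<Longrightarrow> t n = u" "u \<in> range t" unfolding P_def by auto
  have Fp: "finite F" "card F = p" using unif F(1) by (auto simp: uniform_hypergraph_def)
  have "\<rho> (basis_sum p F) = finprod (torus_group d) t F"
    unfolding t_def by (rule hom_basis_sum[OF T.comm_group_axioms p \<rho> Fp(1)])
  also have "\<dots> = finprod (torus_group d) (\<lambda>_. u) F"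
    by (rule T.finprod_cong) (use u tT in auto)
  also have "\<dots> = u [^]\<^bsub>torus_group d\<^esub> p"
    using T.finprod_const[of u F] u(2) tT Fp(2) by auto
  also have "\<dots> = \<one>\<^bsub>torus_group d\<^esub>" using u(2) tp by auto
  finally have "torus_norm d (\<rho> (basis_sum p F)) < \<epsilon>" using \<epsilon> by (simp add: torus_norm_one)
  then show "\<exists>s\<in>edge_vectors p \<F>. torus_norm d (\<rho> s) < \<epsilon>"
    using F(1) unfolding edge_vectors_def by blast
qed

text \<open>Each \<open>\<xi> j\<close> gives a character whose values are multiples of
  \<open>1 / p\<close> modulo 1. Together they form a homomorphism into the torus of dimension
  \<open>K\<close>, and a point with such coordinates and norm below \<open>1 / p\<close> is
  trivial.\<close>

lemma bohr_recurrent_characters: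
  fixes p K :: nat
  assumes p: "p > 0" and S: "S \<subseteq> carrier (Fp_omega p)" "bohr_recurrent (Fp_omega p) S"
  shows "\<exists>s\<in>S. \<exists>m. s \<in> vecs p m \<and> (\<forall>j<K. int p dvd dotp m (\<xi> j) s)"
proof -
  \<comment> \<open>Summing over the support gives one formula on the whole group; it agrees with
    \<open>dotp m\<close> for every \<open>m\<close> beyond the support.\<close>
  define D where "D j x = (\<Sum>i | x i \<noteq> 0. \<xi> j i * x i)" for j and x :: "nat \<Rightarrow> int"
  have D: "D j x = dotp m (\<xi> j) x" if "x \<in> vecs p m" for j x m
    unfolding D_def dotp_def
    by (rule sum.mono_neutral_left) (use that in \<open>auto simp: vecs_def\<close>)
  define \<rho> where "\<rho> x = (\<lambda>j\<in>{..<K}. circle_pt (of_int (D j x) / of_nat p))" for x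
  have "\<rho> \<in> hom (Fp_omega p) (torus_group K)"
  proof (rule homI)
    fix x show "\<rho> x \<in> carrier (torus_group K)" by (auto simp: \<rho>_def carrier_torus_group)
  next
    fix x y assume xy: "x \<in> carrier (Fp_omega p)" "y \<in> carrier (Fp_omega p)"
    define w where "w = x \<otimes>\<^bsub>Fp_omega p\<^esub> y"
    have "w \<in> carrier (Fp_omega p)"
      unfolding w_def using xy group.is_monoid[OF group_Fp_omega] by (intro monoid.m_closed) auto
    then obtain a b c where abc: "x \<in> vecs p a" "y \<in> vecs p b" "w \<in> vecs p c"
      using xy Fp_omega_in_vecs[OF p] by metis
    define m where "m = a + b + c"
    have "vecs p a \<subseteq> vecs p m" "vecs p b \<subseteq> vecs p m" "vecs p c \<subseteq> vecs p m"
      by (rule vecs_mono; simp add: m_def p)+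
    then have m: "x \<in> vecs p m" "y \<in> vecs p m" "w \<in> vecs p m" using abc by auto
    have "circle_pt (of_int (D j w) / of_nat p) =
        circle_pt (of_int (D j x) / of_nat p) \<otimes>\<^bsub>circle_group\<^esub> circle_pt (of_int (D j y) / of_nat p)" for j
    proof -
      \<comment> \<open>The entries of \<open>w\<close> are reduced representatives, so
        \<open>D j\<close> is additive modulo \<open>p\<close>; dividing by \<open>p\<close> turns
        the error into an integer.\<close>
      have "int p dvd (\<Sum>i<m. \<xi> j i * (w i - (x i + y i)))"
        by (intro dvd_sum dvd_mult) (simp add: w_def mult_Fp_omega mod_eq_dvd_iff[symmetric])
      then have "int p dvd D j w - (D j x + D j y)"
        by (simp add: D[OF m(1)] D[OF m(2)] D[OF m(3)] dotp_def sum_subtractf sum.distrib algebra_simps)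
      then obtain k where "D j w - (D j x + D j y) = int p * k" by blast
      then have "real_of_int (D j w) - (of_int (D j x) + of_int (D j y)) = of_nat p * of_int k"
        by (metis of_int_add of_int_diff of_int_mult of_int_of_nat_eq)
      then have "of_int (D j w) / of_nat p - (of_int (D j x) / of_nat p + of_int (D j y) / of_nat p) = real_of_int k"
        using p by (simp add: field_simps)
      then show ?thesis by (simp add: circle_pt_mult circle_pt_eq_iff)
    qed
    then show "\<rho> (x \<otimes>\<^bsub>Fp_omega p\<^esub> y) = \<rho> x \<otimes>\<^bsub>torus_group K\<^esub> \<rho> y"
      by (auto simp: w_def[symmetric] \<rho>_def torus_group_def fun_eq_iff)
  qed
  then obtain s where s: "s \<in> S" "torus_norm K (\<rho> s) < 1 / of_nat p"
    using S(2) p unfolding bohr_recurrent_def by (metis of_nat_0_less_iff zero_less_divide_1_iff)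
  obtain m where m: "s \<in> vecs p m" using s(1) S(1) Fp_omega_in_vecs[OF p] by blast
  have "int p dvd dotp m (\<xi> j) s" if j: "j < K" for j
  proof -
    define x where "x = real_of_int (D j s) / of_nat p"
    have "circle_norm (\<rho> s j) \<le> torus_norm K (\<rho> s)"
      unfolding torus_norm_def by (rule Max_ge) (use j in auto)
    then have "\<bar>x - of_int (round x)\<bar> < 1 / of_nat p"
      using s(2) j by (simp add: \<rho>_def circle_norm_pt x_def)
    then have "of_nat p * \<bar>x - of_int (round x)\<bar> < 1" using p by (simp add: field_simps)
    moreover have "of_nat p * \<bar>x - of_int (round x)\<bar> = \<bar>real_of_int (D j s - int p * round x)\<bar>"
    proof -
      have "real_of_int (D j s - int p * round x) = of_nat p * (x - of_int (round x))"
        using p by (simp add: x_def right_diff_distrib)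
      then show ?thesis by (simp add: abs_mult)
    qed
    \<comment> \<open>An integer of absolute value below 1 is 0.\<close>
    ultimately have "D j s = int p * round x" by linarith
    then show ?thesis using D[OF m] by simp
  qed
  then show ?thesis using s(1) m by blast
qed

section \<open>The hypergraph of a recurrence set\<close>

lemma chromatically_recurrent_imp_Cay_infinite:
  assumes "chromatically_recurrent G S"
  shows "graph_chromatic_number (Cay G (carrier G) S) = \<infinity>"
proof -
  have "\<not> proper_colouring (Cay G (carrier G) S) k c" for k c
  proof
    assume c: "proper_colouring (Cay G (carrier G) S) k c"
    then have "c \<in> carrier G \<rightarrow> {..<k}" by (simp add: proper_colouring_def Cay_def)
    \<comment> \<open>Recurrence colours start at 1, graph colours at 0.\<close>
    then have "(\<lambda>x. Suc (c x)) \<in> carrier G \<rightarrow> {1..k}" by (simp add: Pi_iff Suc_le_eq)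
    then obtain a b where ab: "a \<in> carrier G" "b \<in> carrier G" "c a = c b" "group_diff G b a \<in> S"
      using assms[unfolded chromatically_recurrent_def, rule_format] by (metis nat.inject)
    \<comment> \<open>If \<open>a = b\<close>, the identity lies in \<open>S\<close> and this edge
      is a loop, which yields the same contradiction.\<close>
    then have "{a, b} \<in> snd (Cay G (carrier G) S)" unfolding Cay_def snd_conv by blast
    then have "c a \<noteq> c b" using c ab(1,2) unfolding proper_colouring_def by (simp add: Cay_def)
    then show False using ab(3) by simp
  qed
  then show ?thesis unfolding graph_chromatic_number_def by simp
qed

text \<open>If every group element occurs infinitely often as some g n, an edge can realise a sum in
  which a summand is repeated, such as x + y + (p - 2)z.\<close>

definition sum_hypergraph :: "nat \<Rightarrow> (nat \<Rightarrow> nat \<Rightarrow> int) \<Rightarrow> (nat \<Rightarrow> int) set \<Rightarrow> nat set set" where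
  "sum_hypergraph p g S = {F. finite F \<and> card F = p \<and> (\<lambda>i. (\<Sum>n\<in>F. g n i) mod int p) \<in> S}"

text \<open>Given a finite partition of the indices, colour each group element by a cell containing
  infinitely many of its indices. By Bohr recurrence the characters belonging to this colouring
  vanish at some \<open>s\<close> in \<open>S\<close>. So \<open>s\<close> is x + y - 2z with x, y,
  z of one colour, and \<open>p\<close> indices from the common cell form an edge with sum
  \<open>s\<close>.\<close>

lemma sum_hypergraph_infinite_chromatic:
  assumes p: "odd p" "p > 1" and S: "S \<subseteq> carrier (Fp_omega p)" "bohr_recurrent (Fp_omega p) S"
    and g: "\<And>x. x \<in> carrier (Fp_omega p) \<Longrightarrow> infinite {n. g n = x}"
  shows "hypergraph_chromatic_number (UNIV, sum_hypergraph p g S) = \<infinity>"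
proof -
  have p0: "p > 0" using p by simp
  have "\<not> partition_colourable (UNIV, sum_hypergraph p g S) k" for k
  proof
    assume "partition_colourable (UNIV, sum_hypergraph p g S) k"
    then obtain P where P: "partition_on UNIV P" "finite P"
      and bad: "\<And>F C. F \<in> sum_hypergraph p g S \<Longrightarrow> C \<in> P \<Longrightarrow> \<not> F \<subseteq> C"
      unfolding partition_colourable_def by auto
    have UP: "\<Union>P = UNIV" using P(1) by (simp add: partition_on_def)
    have "\<exists>C\<in>P. infinite (C \<inter> {n. g n = x})" if "x \<in> carrier (Fp_omega p)" for x
    proof (rule ccontr)
      assume "\<not> ?thesis"
      then have "finite (\<Union>C\<in>P. C \<inter> {n. g n = x})" using P(2) by blast
      also have "(\<Union>C\<in>P. C \<inter> {n. g n = x}) = {n. g n = x}" using UP by blast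
      finally show False using g[OF that] by simp
    qed
    then obtain cell where cell: "\<And>x. x \<in> carrier (Fp_omega p) \<Longrightarrow>
        cell x \<in> P \<and> infinite (cell x \<inter> {n. g n = x})"
      by metis
    obtain idx :: "nat set \<Rightarrow> nat" where idx: "inj_on idx P"
      using finite_imp_inj_to_nat_seg[OF P(2)] by blast
    define r where "r = Suc (Max (insert 0 (idx ` P)))"
    \<comment> \<open>Outside the group the default 0 stays below \<open>r\<close>, which is a
      successor.\<close>
    define c where "c x = (if x \<in> carrier (Fp_omega p) then idx (cell x) else 0)" for x
    have "idx C < r" if "C \<in> P" for C
      unfolding r_def less_Suc_eq_le using that P(2) by (intro Max_ge) auto
    then have "range c \<subseteq> {..<r}" using cell by (auto simp: c_def r_def)
    from mono_three_term_characters[OF p(1) this] obtain K :: nat and \<xi> where K: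
      "\<forall>m h. h \<in> vecs p m \<longrightarrow> (\<forall>j<K. int p dvd dotp m (\<xi> j) h) \<longrightarrow>
        (\<exists>n\<ge>m. \<exists>x\<in>vecs p n. \<exists>z\<in>vecs p n. c x = c z \<and> c (reduce_vec p n (z + z - x + h)) = c z)"
      by blast
    from bohr_recurrent_characters[OF p0 S, of K \<xi>] obtain s m where
      s: "s \<in> S" "s \<in> vecs p m" "\<forall>j<K. int p dvd dotp m (\<xi> j) s" by blast
    from K[rule_format, OF s(2)] s(3) obtain n x z where n: "n \<ge> m"
      and xz: "x \<in> vecs p n" "z \<in> vecs p n" "c x = c z" "c (reduce_vec p n (z + z - x + s)) = c z"
      by blast
    define y where "y = reduce_vec p n (z + z - x + s)"
    have y: "y \<in> vecs p n" unfolding y_def by (rule reduce_vec_in_vecs[OF p0])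
    have G: "x \<in> carrier (Fp_omega p)" "y \<in> carrier (Fp_omega p)" "z \<in> carrier (Fp_omega p)"
      using xz(1,2) y vecs_subset_Fp_omega[OF p0] by auto
    define C where "C = cell z"
    have "cell x = C" "cell y = C"
      using xz(3,4) G cell idx unfolding y_def[symmetric] C_def by (auto simp: c_def inj_on_eq_iff)
    then have C: "C \<in> P" "infinite (C \<inter> {n. g n = x})" "infinite (C \<inter> {n. g n = y})"
        "infinite (C \<inter> {n. g n = z})"
      using cell G unfolding C_def by metis+
    \<comment> \<open>First \<open>p - 2\<close> indices for \<open>z\<close>, then fresh ones for
      \<open>x\<close> and \<open>y\<close>; the infinite supply keeps them distinct even if some of
      \<open>x\<close>, \<open>y\<close>, \<open>z\<close> coincide.\<close>
    obtain A where A: "finite A" "card A = p - 2" "A \<subseteq> C \<inter> {n. g n = z}"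
      using infinite_arbitrarily_large[OF C(4)] by blast
    obtain a where a: "a \<in> C" "g a = x" "a \<notin> A"
      using infinite_imp_nonempty[OF Diff_infinite_finite[OF A(1) C(2)]] by blast
    have "finite (insert a A)" using A(1) by simp
    from infinite_imp_nonempty[OF Diff_infinite_finite[OF this C(3)]]
    obtain b where b: "b \<in> C" "g b = y" "b \<notin> insert a A" by blast
    define F where "F = insert b (insert a A)"
    have "p \<ge> 2" using p by simp
    then have F: "finite F" "card F = p" "F \<subseteq> C"
      using A a b by (auto simp: F_def)
    have sum: "(\<Sum>k\<in>F. g k i) = y i + x i + int (p - 2) * z i" for i
    proof -
      have "(\<Sum>k\<in>A. g k i) = (\<Sum>k\<in>A. z i)" by (rule sum.cong) (use A(3) in auto)
      then show ?thesis using A a b by (simp add: F_def)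
    qed
    have "(\<lambda>i. (\<Sum>k\<in>F. g k i) mod int p) = s"
    proof
      fix i
      have sn: "s \<in> vecs p n" using vecs_mono[OF n p0] s(2) by blast
      show "(\<Sum>k\<in>F. g k i) mod int p = s i"
      proof (cases "i < n")
        case True
        have "(\<Sum>k\<in>F. g k i) mod int p = ((z i + z i - x i + s i) + x i + int (p - 2) * z i) mod int p"
          unfolding sum using True by (simp add: y_def reduce_vec_nth mod_simps add.assoc)
        \<comment> \<open>The multiplicity \<open>p - 2\<close> acts as -2 modulo \<open>p\<close>
          and cancels \<open>z i + z i\<close>.\<close>
        also have "(z i + z i - x i + s i) + x i + int (p - 2) * z i = s i + int p * z i"
          using \<open>p \<ge> 2\<close> by (simp add: of_nat_diff algebra_simps)
        also have "\<dots> mod int p = s i" using sn True by (auto simp: vecs_def)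
        finally show ?thesis .
      next
        case False
        then have "x i = 0" "y i = 0" "z i = 0" "s i = 0" using xz(1,2) y sn by (auto simp: vecs_def)
        then show ?thesis by (simp add: sum)
      qed
    qed
    then have "F \<in> sum_hypergraph p g S" using F(1,2) s(1) by (simp add: sum_hypergraph_def)
    then show False using bad[OF _ C(1)] F(3) by blast
  qed
  then show ?thesis unfolding hypergraph_chromatic_number_def by simp
qed

text \<open>The homomorphism \<open>\<phi>\<close> sends the \<open>n\<close>-th basis vector to
  \<open>g n\<close>, hence the vector of an edge to its sum, which lies in \<open>S\<close>. The
  pullback of \<open>f\<close> along \<open>\<phi>\<close> is not proper, and the images of two
  adjacent vertices of equal colour have a difference in \<open>S\<close>.\<close>

lemma chromatically_recurrent_of_sum_hypergraph:
  assumes p: "p > 1" and g: "\<And>n. g n \<in> carrier (Fp_omega p)"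
    and chi: "graph_chromatic_number (Cay (Fp_omega p) (carrier (Fp_omega p))
        (edge_vectors p (sum_hypergraph p g S))) = \<infinity>"
  shows "chromatically_recurrent (Fp_omega p) S"
  unfolding chromatically_recurrent_def
proof (intro allI ballI)
  fix r :: nat and f :: "(nat \<Rightarrow> int) \<Rightarrow> nat"
  assume f: "f \<in> carrier (Fp_omega p) \<rightarrow> {1..r}"
  let ?G = "carrier (Fp_omega p)"
  have p0: "p > 0" using p by simp
  define \<phi> where "\<phi> x i = (\<Sum>n | x n \<noteq> 0. x n * g n i) mod int p" for x i
  have \<phi>: "\<phi> x i = (\<Sum>n<m. x n * g n i) mod int p" if "x \<in> vecs p m" for x m i
    unfolding \<phi>_def
    by (rule arg_cong[where f = "\<lambda>k. k mod int p"], rule sum.mono_neutral_left)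
      (use that in \<open>auto simp: vecs_def\<close>)
  have \<phi>G: "\<phi> x \<in> ?G" if "x \<in> ?G" for x
  proof -
    from Fp_omega_in_vecs[OF p0 that] obtain m where m: "x \<in> vecs p m" .
    have "{i. \<phi> x i \<noteq> 0} \<subseteq> (\<Union>n<m. {i. g n i \<noteq> 0})"
    proof
      fix i assume "i \<in> {i. \<phi> x i \<noteq> 0}"
      then have "(\<Sum>n<m. x n * g n i) \<noteq> 0" using \<phi>[OF m, of i] by auto
      then obtain n where "n < m" "x n * g n i \<noteq> 0" by (meson lessThan_iff sum.not_neutral_contains_not_neutral)
      then show "i \<in> (\<Union>n<m. {i. g n i \<noteq> 0})" by auto
    qed
    moreover have "finite (\<Union>n<m. {i. g n i \<noteq> 0})" using g p0 by (simp add: carrier_Fp_omega)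
    ultimately have "finite {i. \<phi> x i \<noteq> 0}" by (rule finite_subset)
    then show ?thesis using p0 by (simp add: carrier_Fp_omega \<phi>_def)
  qed
  \<comment> \<open>Subtracting 1 moves the colours to \<open>{..<r}\<close>, injectively because
    \<open>f\<close> is at least 1 on the group.\<close>
  have "\<not> proper_colouring (Cay (Fp_omega p) ?G (edge_vectors p (sum_hypergraph p g S))) r (\<lambda>x. f (\<phi> x) - 1)"
    using chi unfolding graph_chromatic_number_def by (auto split: if_splits)
  moreover have "f (\<phi> x) - 1 < r" "f (\<phi> x) \<ge> 1" if "x \<in> ?G" for x
    using funcset_mem[OF f \<phi>G[OF that]] by auto
  ultimately obtain u v where uv: "u \<in> ?G" "v \<in> ?G" "f (\<phi> u) = f (\<phi> v)"
      "{u, v} \<in> snd (Cay (Fp_omega p) ?G (edge_vectors p (sum_hypergraph p g S)))"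
    unfolding proper_colouring_def Cay_def
    by (auto simp: Pi_iff) (metis diff_add_inverse2 le_add_diff_inverse2)+
  \<comment> \<open>Edges are unordered, so the two vertices may have to be swapped to get the
    difference in this order.\<close>
  then obtain a b where ab: "a \<in> ?G" "b \<in> ?G" "f (\<phi> a) = f (\<phi> b)"
      "group_diff (Fp_omega p) b a \<in> edge_vectors p (sum_hypergraph p g S)"
    unfolding Cay_def by (auto simp: doubleton_eq_iff)
  then obtain F where F: "F \<in> sum_hypergraph p g S" "group_diff (Fp_omega p) b a = basis_sum p F"
    by (auto simp: edge_vectors_def)
  have finF: "finite F" and FS: "(\<lambda>i. (\<Sum>n\<in>F. g n i) mod int p) \<in> S"
    using F(1) by (auto simp: sum_hypergraph_def)
  have diff: "(b n - a n) mod int p = (if n \<in> F then 1 else 0)" for n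
    using fun_cong[OF F(2), of n] by (simp add: group_diff_Fp_omega[OF p0 ab(1,2)] basis_sum_eq[OF p finF])
  obtain k l where "a \<in> vecs p k" "b \<in> vecs p l"
    using ab(1,2) Fp_omega_in_vecs[OF p0] by metis
  moreover obtain t where t: "F \<subseteq> {..<t}" using finF finite_nat_iff_bounded by blast
  define m where "m = k + l + t"
  have "vecs p k \<subseteq> vecs p m" "vecs p l \<subseteq> vecs p m" by (rule vecs_mono; simp add: m_def p0)+
  ultimately have m: "a \<in> vecs p m" "b \<in> vecs p m" by auto
  have Fm: "F \<subseteq> {..<m}" using t by (auto simp: m_def)
  have "group_diff (Fp_omega p) (\<phi> b) (\<phi> a) = (\<lambda>i. (\<Sum>n\<in>F. g n i) mod int p)"
    unfolding group_diff_Fp_omega[OF p0 \<phi>G[OF ab(1)] \<phi>G[OF ab(2)]]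
  proof
    fix i
    have "(\<phi> b i - \<phi> a i) mod int p = (\<Sum>n<m. (b n - a n) * g n i) mod int p"
      by (simp add: \<phi>[OF m(1)] \<phi>[OF m(2)] mod_simps left_diff_distrib sum_subtractf)
    also have "\<dots> = (\<Sum>n<m. ((b n - a n) * g n i) mod int p) mod int p" by (rule mod_sum_eq[symmetric])
    also have "\<dots> = (\<Sum>n<m. ((if n \<in> F then 1 else 0) * g n i) mod int p) mod int p"
      unfolding diff[symmetric] by (simp only: mod_mult_left_eq)
    also have "\<dots> = (\<Sum>n<m. (if n \<in> F then 1 else 0) * g n i) mod int p" by (rule mod_sum_eq)
    also have "(\<Sum>n<m. (if n \<in> F then 1 else 0) * g n i) = (\<Sum>n\<in>F. g n i)"
      using Fm by (intro sum.mono_neutral_cong_right) auto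
    finally show "(\<phi> b i - \<phi> a i) mod int p = (\<Sum>n\<in>F. g n i) mod int p" .
  qed
  then show "\<exists>a\<in>?G. \<exists>b\<in>?G. f a = f b \<and> group_diff (Fp_omega p) b a \<in> S"
    using FS ab(3) \<phi>G[OF ab(1)] \<phi>G[OF ab(2)] by metis
qed

section \<open>Enumeration of the group and the equivalence\<close>

lemma countable_Fp_omega:
  assumes "p > 0" shows "countable (carrier (Fp_omega p))"
proof (rule countable_subset)
  show "carrier (Fp_omega p) \<subseteq> (\<Union>n. vecs p n)" using Fp_omega_in_vecs[OF assms] by blast
  show "countable (\<Union>n. vecs p n)" by (intro countable_UN) (simp_all add: countable_finite)
qed

text \<open>\<open>g\<close> reads only the first component of the decoded pair; the free second
  component repeats every value infinitely often.\<close>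

lemma enumeration_infinite_fibres:
  assumes "countable A" "A \<noteq> {}"
  shows "\<exists>g :: nat \<Rightarrow> 'a. (\<forall>n. g n \<in> A) \<and> (\<forall>x\<in>A. infinite {n. g n = x})"
proof -
  define g where "g n = from_nat_into A (fst (prod_decode n))" for n
  have "infinite {n. g n = x}" if x: "x \<in> A" for x
  proof -
    obtain k where k: "from_nat_into A k = x" using from_nat_into_surj[OF assms(1) x] by blast
    have "range (\<lambda>l. prod_encode (k, l)) \<subseteq> {n. g n = x}" by (auto simp: g_def k)
    moreover have "infinite (range (\<lambda>l. prod_encode (k, l)))"
      by (rule range_inj_infinite) (auto simp: inj_def prod_encode_eq)
    ultimately show ?thesis using finite_subset by blast
  qed
  moreover have "g n \<in> A" for n unfolding g_def by (rule from_nat_into[OF assms(2)])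
  ultimately show ?thesis by blast
qed

theorem mainTheorem4:
  fixes p :: nat
  assumes "prime p" and "odd p"
  shows
    "(\<forall>\<F> :: nat set set.
        uniform_hypergraph p (UNIV, \<F>) \<and> hypergraph_chromatic_number (UNIV, \<F>) = \<infinity> \<longrightarrow>
        graph_chromatic_number (Cay (Fp_omega p) (carrier (Fp_omega p)) (edge_vectors p \<F>)) = \<infinity>)
     \<longleftrightarrow>
     (\<forall>S \<subseteq> carrier (Fp_omega p).
        bohr_recurrent (Fp_omega p) S \<longrightarrow> chromatically_recurrent (Fp_omega p) S)"
    (is "?A \<longleftrightarrow> ?B")
proof
  have p: "p > 1" using assms(1) by (rule prime_gt_1_nat)
  interpret comm_group "Fp_omega p" by (rule comm_group_Fp_omega)
  {
    assume B: ?B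
    show ?A
    proof (intro allI impI, elim conjE)
      fix \<F> :: "nat set set"
      assume \<F>: "uniform_hypergraph p (UNIV, \<F>)" "hypergraph_chromatic_number (UNIV, \<F>) = \<infinity>"
      have "basis_sum p F \<in> carrier (Fp_omega p)" for F
        unfolding basis_sum_def by (rule finprod_closed) (use basis_vec_in_Fp_omega[OF p] in simp)
      then have "edge_vectors p \<F> \<subseteq> carrier (Fp_omega p)" by (auto simp: edge_vectors_def)
      with B bohr_recurrent_edge_vectors[OF p \<F>]
      have "chromatically_recurrent (Fp_omega p) (edge_vectors p \<F>)" by simp
      then show "graph_chromatic_number (Cay (Fp_omega p) (carrier (Fp_omega p)) (edge_vectors p \<F>)) = \<infinity>"
        by (rule chromatically_recurrent_imp_Cay_infinite)
    qed
  next
    assume A: ?A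
    show ?B
    proof (intro allI impI)
      fix S assume S: "S \<subseteq> carrier (Fp_omega p)" "bohr_recurrent (Fp_omega p) S"
      have count: "countable (carrier (Fp_omega p))" using p by (intro countable_Fp_omega) simp
      have ne: "carrier (Fp_omega p) \<noteq> {}" using one_closed by blast
      from enumeration_infinite_fibres[OF count ne] obtain g :: "nat \<Rightarrow> nat \<Rightarrow> int" where
        g: "\<forall>n. g n \<in> carrier (Fp_omega p)"
          "\<forall>x\<in>carrier (Fp_omega p). infinite {n. g n = x}"
        by blast
      have "uniform_hypergraph p (UNIV, sum_hypergraph p g S)"
        by (simp add: uniform_hypergraph_def sum_hypergraph_def)
      moreover have "hypergraph_chromatic_number (UNIV, sum_hypergraph p g S) = \<infinity>"
        by (rule sum_hypergraph_infinite_chromatic[OF assms(2) p S g(2)[rule_format]])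
      ultimately show "chromatically_recurrent (Fp_omega p) S"
        using A g(1) by (intro chromatically_recurrent_of_sum_hypergraph[where g = g, OF p]) simp_all
    qed
  }
qed

end
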